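(* Let $d\ge 3$ and $n\ge d+1$ be integers, and let $\mathcal{P}_{d,n}$ be the set of all $d$-dimensional convex polytopes in $\mathbb{R}^d$ with exactly $n$ vertices. Then \[ \max_{P\in\mathcal{P}_{d,n}} \nu(P) \] is attained by the cyclic polytope $C_d(n)$, and it is equal to $2(n-2)$ if $d=3$ and to $\lfloor n/2\rfloor\,\lceil n/2\rceil$ if $d>3$.
   Context: For a $d$-dimensional convex polytope $P\subset\mathbb{R}^d$, let $\mathcal{H}_P$ be the set of affine hyperplanes $H\subset\mathbb{R}^d$ with $H\cap P\neq\emptyset$. For $H\in\mathcal{H}_P$ the polytope $H\cap P$ is called a slice of $P$; put $cv_P(H)=|V(H\cap P)|$, the number of vertices of the slice, and $\nu(P)=\max_{H\in\mathcal{H}_P} cv_P(H)$. The cyclic polytope $C_d(n)$ is the convex hull of $n$ points $\gamma(t_1),\dots,\gamma(t_n)$ on the moment curve $\gamma(t)=(t,t^2,\dots,t^d)\in\mathbb{R}^d$, where $t_1<\dots<t_n$ are real numbers. *)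

theory Defs
  imports "HOL-Analysis.Analysis"
begin

definition vertices :: "'a::euclidean_space set \<Rightarrow> 'a set" where
  "vertices P = {v. v extreme_point_of P}"

definition slicing_hyperplanes :: "'a::euclidean_space set \<Rightarrow> 'a set set" where
  "slicing_hyperplanes P = {H. (\<exists>a b. a \<noteq> 0 \<and> H = {x. a \<bullet> x = b}) \<and> H \<inter> P \<noteq> {}}"

definition cv :: "'a::euclidean_space set \<Rightarrow> 'a set \<Rightarrow> nat" where
  "cv P H = card (vertices (H \<inter> P))"

(* For a polytope P the set below is finite: distinct vertices of a slice lie in the relative
   interiors of distinct faces of P, so cv P H is at most the number of faces of P. *)
definition \<nu> :: "'a::euclidean_space set \<Rightarrow> nat" where
  "\<nu> P = Max (cv P ` slicing_hyperplanes P)"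

definition full_polytopes :: "nat \<Rightarrow> 'a::euclidean_space set set" where
  "full_polytopes n = {P. polytope P \<and> aff_dim P = int DIM('a) \<and> card (vertices P) = n}"

(* The type 'd carries no order, so the coordinates of real ^ 'd are numbered explicitly:
   idx is meant to be a bijection from 'd onto {1..CARD('d)}. *)
definition moment_curve :: "('d::finite \<Rightarrow> nat) \<Rightarrow> real \<Rightarrow> real ^ 'd" where
  "moment_curve idx s = (\<chi> i. s ^ idx i)"

definition cyclic_polytope :: "('d::finite \<Rightarrow> nat) \<Rightarrow> nat \<Rightarrow> (nat \<Rightarrow> real) \<Rightarrow> (real ^ 'd) set" where
  "cyclic_polytope idx n t = convex hull ((\<lambda>k. moment_curve idx (t k)) ` {1..n})"

end

theory Submission imports Defs "HOL-Library.Sublist"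
begin

text \<open>
  A vertex of the slice of \<open>P\<close> by a hyperplane \<open>H\<close> is a vertex of \<open>P\<close> on \<open>H\<close>, or the point where \<open>H\<close> crosses
  an edge of \<open>P\<close> (\<open>slice_vertex_cases\<close>). So, if \<open>A\<close>, \<open>B\<close> and \<open>Z\<close> are the vertices of \<open>P\<close> above, below and on
  \<open>H\<close>, the slice has at most \<open>card Z\<close> vertices more than there are edges between \<open>A\<close> and \<open>B\<close>. There are
  at most \<open>card A * card B\<close> such edges, and this gives \<open>\<lfloor>n/2\<rfloor> * \<lceil>n/2\<rceil>\<close> in every dimension.

  In dimension 3 there are at most \<open>2 * (card A + card B) - 4\<close> of them, provided that there are at
  least two. In place of Euler's formula the proof uses the cyclic order of the vertices of the
  plane slice. Label each vertex on a crossed edge by the ends of that edge. Labels in \<open>A\<close> cannot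
  alternate as \<open>x, y, x, y\<close> around the slice: every crossed edge has a supporting plane that meets \<open>P\<close> in this edge alone, the
  traces of these planes on \<open>H\<close> are tangent lines of the slice, and for four of them in cyclic order a
  positive combination of the first and the third functional equals one of the second and the
  fourth on \<open>H\<close> (\<open>tangent_line_cyclic_order\<close>). Off \<open>H\<close> the two sides differ by a multiple of the
  equation of \<open>H\<close>, and an alternation would force this multiple to be both positive and negative on
  \<open>A\<close> (\<open>noncrossing_labels\<close>). A cyclic sequence without such alternations changes at most
  \<open>2 * (card A - 1)\<close> times. The same is true for \<open>B\<close>, and each step around the slice changes at least
  one of the two labels (\<open>length_noncrossing_pairs_le\<close>).

  The cyclic polytope attains these bounds, for every choice of the parameters. Affine functionals on the
  moment curve are polynomials of degree at most \<open>d\<close>, so a polynomial that is nonnegative at the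
  parameters and vanishes at exactly two of them exhibits an edge. For \<open>d \<ge> 4\<close> all pairs are edges, and
  a hyperplane with half of the vertices on each side works; for \<open>d = 3\<close> a plane that separates the first
  and the last vertex from the others does.
\<close>

section \<open>Sequences without alternation\<close>

text \<open>
These are the Davenport--Schinzel sequences of order 2, except that a letter may be repeated
immediately. For points on a circle, listed in order, they are the labellings whose classes have
disjoint convex hulls.
\<close>

definition noncrossing :: "'a list \<Rightarrow> bool" where
  "noncrossing xs \<longleftrightarrow> (\<forall>x y. x \<noteq> y \<longrightarrow> \<not> subseq [x, y, x, y] xs)"

lemma noncrossing_subseq:
  assumes "noncrossing ys" "subseq xs ys"
  shows "noncrossing xs"
  using assms subseq_order.trans unfolding noncrossing_def by blast

lemma length_remdups_adj_append:
  "length (remdups_adj (xs @ ys)) \<le> length (remdups_adj xs) + length (remdups_adj ys)"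
proof (induction xs rule: remdups_adj.induct)
  case (2 x)
  then show ?case by (simp add: remdups_adj_Cons split: list.splits)
qed auto

text \<open>
The Davenport--Schinzel bound. If the first letter \<open>x\<close> comes back, its first return splits the
word into a block \<open>zs\<close> and a rest that begins with \<open>x\<close>. A letter in both would alternate with \<open>x\<close>,
so the two parts use disjoint alphabets and the bounds for them add up.
\<close>

lemma length_remdups_adj_noncrossing:
  assumes "noncrossing xs" "xs \<noteq> []"
  shows "length (remdups_adj xs) + 1 \<le> 2 * card (set xs)"
  using assms
proof (induction xs rule: length_induct)
  case (1 xs)
  then obtain x ys where xs: "xs = x # ys" by (cases xs) auto
  show ?case
  proof (cases "x \<in> set ys")
    case False
    show ?thesis
    proof (cases "ys = []")
      case False
      have "noncrossing ys" by (rule noncrossing_subseq[OF "1.prems"(1)]) (auto simp: xs)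
      then have "length (remdups_adj ys) + 1 \<le> 2 * card (set ys)"
        using "1.IH" False by (simp add: xs)
      moreover have "length (remdups_adj xs) \<le> length (remdups_adj ys) + 1"
        using length_remdups_adj_append[of "[x]" ys] by (simp add: xs)
      ultimately show ?thesis using \<open>x \<notin> set ys\<close> by (simp add: xs)
    qed (simp add: xs)
  next
    case True
    then obtain zs ws where ys: "ys = zs @ x # ws" and x: "x \<notin> set zs"
      by (meson split_list_first)
    have nc: "noncrossing zs" "noncrossing (x # ws)"
      by (rule noncrossing_subseq[OF "1.prems"(1)]; force simp: xs ys intro: subseq_drop_many)+
    have tail: "length (remdups_adj (x # ws)) + 1 \<le> 2 * card (set (x # ws))"
      using "1.IH"[rule_format, OF _ nc(2)] by (simp add: xs ys)
    show ?thesis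
    proof (cases "zs = []")
      case True
      then show ?thesis using tail by (simp add: xs ys)
    next
      case False
      have front: "length (remdups_adj zs) + 1 \<le> 2 * card (set zs)"
        using "1.IH"[rule_format, OF _ nc(1)] False by (simp add: xs ys)
      have "set zs \<inter> set (x # ws) = {}"
      proof (rule ccontr)
        assume "\<not> ?thesis"
        then obtain z where z: "z \<in> set zs" "z \<in> set ws" "z \<noteq> x" using x by auto
        have "subseq ([x] @ [z] @ [x] @ [z]) ([x] @ zs @ [x] @ ws)"
          using z by (intro list_emb_append_mono) (auto simp: subseq_singleton_left)
        then have "subseq [x, z, x, z] xs" by (simp add: xs ys)
        then show False using "1.prems"(1) z(3) unfolding noncrossing_def by metis
      qed
      then have "card (set xs) = card (set zs) + card (set (x # ws))"
        by (subst card_Un_disjoint[symmetric]) (auto simp: xs ys intro!: arg_cong[where f=card])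
      moreover have "length (remdups_adj xs)
          \<le> 1 + (length (remdups_adj zs) + length (remdups_adj (x # ws)))"
        using length_remdups_adj_append[of "[x]" ys] length_remdups_adj_append[of zs "x # ws"]
        by (simp add: xs ys)
      ultimately show ?thesis using front tail by linarith
    qed
  qed
qed

text \<open>
Closing up the word makes the count below cyclic: the change from the last letter back to the
first one is counted too, which is what makes the final bound sharp.
\<close>

lemma noncrossing_close:
  assumes "noncrossing (x # xs)"
  shows "noncrossing (x # xs @ [x])"
  unfolding noncrossing_def
proof (intro allI impI notI)
  fix y z assume yz: "y \<noteq> z" and s: "subseq [y, z, y, z] (x # xs @ [x])"
  have s': "subseq ([y, z, y] @ [z]) ((x # xs) @ [x])" using s by simp
  show False
  proof (cases "z = x")
    case True
    have "subseq [y, z, y] (x # xs)"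
      using s' True subseq_append[of "[y,z,y]" "[x]" "x # xs"] by simp
    then have "subseq [z, y, z, y] (x # xs)" using True yz by simp
    then show False using assms yz unfolding noncrossing_def by metis
  next
    case False
    from s' have "subseq ([y, z, y] @ [z]) (x # xs)"
      unfolding subseq_append_iff[of _ "x # xs" "[x]"]
      using False by (auto simp: append_eq_append_conv2 append_eq_Cons_conv Cons_eq_append_conv)
    then show False using assms yz unfolding noncrossing_def by simp
  qed
qed

text \<open>
\<open>length (remdups_adj ys)\<close> is one more than the number of changes along \<open>ys\<close>, and at each of the
\<open>length xs - 1\<close> steps at least one of the two labels changes.
\<close>

lemma length_le_remdups_adj_pair:
  assumes "successively (\<lambda>p q. u p \<noteq> u q \<or> w p \<noteq> w q) xs" "xs \<noteq> []"
  shows "length xs + 1 \<le> length (remdups_adj (map u xs)) + length (remdups_adj (map w xs))"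
  using assms
proof (induction xs rule: induct_list012)
  case (3 x y xs)
  then have "length (y # xs) + 1
      \<le> length (remdups_adj (map u (y # xs))) + length (remdups_adj (map w (y # xs)))"
    by simp
  then show ?case using "3.prems"(1) by auto
qed auto

lemma length_remdups_adj_closed_noncrossing:
  assumes nf: "noncrossing (map f (x # ys))" and A: "finite A" "f ` set (x # ys) \<subseteq> A"
  shows "length (remdups_adj (map f (x # ys @ [x]))) + 1 \<le> 2 * card A"
proof -
  have "length (remdups_adj (map f (x # ys @ [x]))) + 1 \<le> 2 * card (f ` set (x # ys))"
    using length_remdups_adj_noncrossing[OF noncrossing_close, of "f x" "map f ys"] nf
    by (simp add: insert_absorb)
  then show ?thesis using card_mono[OF A] by linarith
qed

text \<open>
Around the cycle \<open>xs\<close> the first label changes at most \<open>2 * (card U - 1)\<close> times and the second at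
most \<open>2 * (card W - 1)\<close> times, while each of the \<open>length xs\<close> steps changes one of them. This takes
the place of the bound \<open>2 * v - 4\<close> for the edges of a planar bipartite graph, with no appeal to
Euler's formula.
\<close>

lemma length_noncrossing_pairs_le:
  assumes nu: "noncrossing (map u xs)" and nw: "noncrossing (map w xs)"
    and dist: "distinct xs" and len: "length xs \<ge> 2"
    and inj: "inj_on (\<lambda>p. (u p, w p)) (set xs)"
    and U: "finite U" "u ` set xs \<subseteq> U" and W: "finite W" "w ` set xs \<subseteq> W"
  shows "length xs + 4 \<le> 2 * (card U + card W)"
proof -
  obtain x ys where xs: "xs = x # ys" "ys \<noteq> []" using len by (cases xs; cases "tl xs") auto
  have "successively (\<noteq>) xs"
    using remdups_adj_distinct[OF dist] distinct_adj_altdef[of xs] by (simp add: distinct_adj_def)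
  moreover have "last xs \<noteq> x" using dist xs by auto
  ultimately have "successively (\<noteq>) (xs @ [x])" by (simp add: successively_append_iff)
  then have "successively (\<lambda>p q. u p \<noteq> u q \<or> w p \<noteq> w q) (xs @ [x])"
    by (rule successively_mono) (use inj xs in \<open>auto simp: inj_on_def\<close>)
  from length_le_remdups_adj_pair[OF this]
  have "length xs + 2
      \<le> length (remdups_adj (map u (x # ys @ [x]))) + length (remdups_adj (map w (x # ys @ [x])))"
    by (simp add: xs)
  moreover note length_remdups_adj_closed_noncrossing[OF nu[unfolded xs] U[unfolded xs]]
    length_remdups_adj_closed_noncrossing[OF nw[unfolded xs] W[unfolded xs]]
  ultimately show ?thesis unfolding add_mult_distrib2 by presburger
qed

section \<open>Vertices of a slice\<close>

text \<open>
A minimal face that contains \<open>p\<close> will do, because a point of its relative frontier is in a smaller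
face.
\<close>

lemma point_in_rel_interior_of_face:
  fixes P :: "'a::euclidean_space set"
  assumes P: "polytope P" and p: "p \<in> P"
  obtains F where "F face_of P" "p \<in> rel_interior F"
proof -
  let ?A = "{F. F face_of P \<and> p \<in> F}"
  have "finite ?A" using finite_polytope_faces[OF P] by (auto intro: finite_subset)
  moreover have "P \<in> ?A" using p face_of_refl[OF polytope_imp_convex[OF P]] by simp
  ultimately obtain F where F: "F \<in> ?A" and min: "\<And>G. G \<in> ?A \<Longrightarrow> G \<subseteq> F \<Longrightarrow> F = G"
    using finite_has_minimal[of ?A] by blast
  have pF: "polytope F" using F P face_of_polytope_polytope by blast
  have "p \<in> rel_interior F"
  proof (rule ccontr)
    assume "p \<notin> rel_interior F"
    then have "p \<in> rel_frontier F"
      using F polytope_imp_closed[OF pF] by (simp add: rel_frontier_def)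
    then obtain G where "G face_of F" "G \<noteq> F" "p \<in> G"
      using rel_frontier_of_polyhedron_alt[OF polytope_imp_polyhedron[OF pF]] by auto
    then show False using F min[of G] face_of_trans face_of_imp_subset by blast
  qed
  then show ?thesis using F that by blast
qed

text \<open>
Let \<open>F\<close> be the face of \<open>P\<close> with \<open>p\<close> in its relative interior. A second point of \<open>F\<close> in the
hyperplane would put \<open>p\<close> inside a segment of the slice; so the hyperplane meets \<open>F\<close> in \<open>p\<close> alone,
which forces \<open>F\<close> to be a point or a segment.
\<close>

lemma slice_vertex_cases:
  fixes P :: "'a::euclidean_space set"
  assumes P: "polytope P" and ext: "p extreme_point_of ({x. a \<bullet> x = b} \<inter> P)" and pnot: "p \<notin> vertices P"
  obtains u w where "u \<in> vertices P" "w \<in> vertices P" "a \<bullet> u > b" "a \<bullet> w < b"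
    "p \<in> open_segment u w" "closed_segment u w face_of P"
proof -
  have pP: "p \<in> P" and pH: "a \<bullet> p = b" using ext by (auto simp: extreme_point_of_def)
  obtain F where F: "F face_of P" and pF: "p \<in> rel_interior F"
    using point_in_rel_interior_of_face[OF P pP] .
  have polF: "polytope F" using F P face_of_polytope_polytope by blast
  then have cF: "convex F" and compF: "compact F" by (auto simp: polytope_imp_convex polytope_imp_compact)
  have FP: "F \<subseteq> P" using F face_of_imp_subset by blast
  have pinF: "p \<in> F" using subsetD[OF rel_interior_subset pF] .
  have prolong: "\<exists>e>0. p + e *\<^sub>R (p - x) \<in> F" if xF: "x \<in> F" for x
  proof -
    obtain e where e: "e > 1" "(1 - e) *\<^sub>R x + e *\<^sub>R p \<in> F"
      using bspec[OF convex_rel_interior_if2[OF cF pF] hull_inc[OF xF]] by blast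
    have "(1 - e) *\<^sub>R x + e *\<^sub>R p = p + (e - 1) *\<^sub>R (p - x)" by (simp add: algebra_simps)
    then show ?thesis using e by (intro exI[of _ "e - 1"]) auto
  qed
  have FH: "x = p" if x: "x \<in> F" "a \<bullet> x = b" for x
  proof (rule ccontr)
    assume ne: "x \<noteq> p"
    obtain e where e: "e > 0" "p + e *\<^sub>R (p - x) \<in> F" using prolong[OF x(1)] by blast
    define y where "y = p + e *\<^sub>R (p - x)"
    have "a \<bullet> y = b" using x pH by (simp add: y_def inner_simps)
    moreover have "p \<in> open_segment x y"
      unfolding in_segment
    proof (intro conjI exI)
      show "x \<noteq> y"
      proof
        assume "x = y"
        then have "(1 + e) *\<^sub>R (p - x) = 0" by (simp add: y_def algebra_simps)
        then show False using e ne by auto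
      qed
      show "0 < 1 / (1 + e)" "1 / (1 + e) < 1" using e by auto
      have "(1 + e) *\<^sub>R p = (1 + e) *\<^sub>R ((1 - 1 / (1 + e)) *\<^sub>R x + (1 / (1 + e)) *\<^sub>R y)"
        using e by (simp add: y_def algebra_simps divide_simps)
      then show "p = (1 - 1 / (1 + e)) *\<^sub>R x + (1 / (1 + e)) *\<^sub>R y" using e
        by (metis add_pos_pos less_irrefl scaleR_cancel_left zero_less_one)
    qed
    ultimately show False using ext x e FP unfolding extreme_point_of_def y_def by auto
  qed
  have "F \<noteq> {p}" using F pnot by (auto simp: vertices_def face_of_singleton)
  then obtain x where x: "x \<in> F" "x \<noteq> p" using pinF by blast
  then have ax: "a \<bullet> x \<noteq> b" using FH by blast
  \<comment> \<open>A segment of \<open>F\<close> between the two sides of the hyperplane passes through \<open>p\<close>. If \<open>y\<close> lies on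
    the same side as \<open>x\<close>, replace \<open>x\<close> by a point beyond \<open>p\<close> on the line from \<open>x\<close> through \<open>p\<close>.\<close>
  have line: "\<exists>c. y = p + c *\<^sub>R (x - p)" if y: "y \<in> F" for y
  proof -
    have cross: "\<exists>c. y = p + c *\<^sub>R (z - p)"
      if z: "z \<in> F" and opp: "(a \<bullet> z - b) * (a \<bullet> y - b) < 0" for z
    proof -
      define r where "r = (a \<bullet> y - b) / (a \<bullet> y - a \<bullet> z)"
      have ne: "a \<bullet> y \<noteq> a \<bullet> z" and r: "0 \<le> r" "r < 1" "0 < r"
        using opp by (auto simp: r_def divide_simps mult_less_0_iff)
      have "a \<bullet> ((1 - r) *\<^sub>R y + r *\<^sub>R z) = b" using ne
        by (simp add: r_def inner_simps divide_simps) (simp add: algebra_simps)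
      moreover have "(1 - r) *\<^sub>R y + r *\<^sub>R z \<in> F" using cF y z r by (simp add: convex_alt)
      ultimately have "(1 - r) *\<^sub>R y + r *\<^sub>R z = p" using FH by blast
      then have "(1 - r) *\<^sub>R (y - p) = (- r) *\<^sub>R (z - p)" by (simp add: algebra_simps)
      then have "(1 / (1 - r)) *\<^sub>R ((1 - r) *\<^sub>R (y - p)) = (1 / (1 - r)) *\<^sub>R ((- r) *\<^sub>R (z - p))" by simp
      then have "y - p = (- r / (1 - r)) *\<^sub>R (z - p)" using r by simp
      then show ?thesis by (metis add.commute diff_add_cancel)
    qed
    show ?thesis
    proof (cases "a \<bullet> y = b")
      case True
      then show ?thesis using FH[OF y] by (intro exI[of _ 0]) simp
    next
      case False
      obtain e where e: "e > 0" "p + e *\<^sub>R (p - x) \<in> F" using prolong[OF x(1)] by blast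
      define z where "z = p + e *\<^sub>R (p - x)"
      have az: "a \<bullet> z - b = - e * (a \<bullet> x - b)" using pH by (simp add: z_def inner_simps algebra_simps)
      show ?thesis
      proof (cases "(a \<bullet> x - b) * (a \<bullet> y - b) < 0")
        case True
        then show ?thesis using cross[OF x(1)] by blast
      next
        case nneg: False
        then have "(a \<bullet> x - b) * (a \<bullet> y - b) > 0" using ax False
          by (meson diff_eq_eq eq_iff_diff_eq_0 linorder_neqE_linordered_idom mult_eq_0_iff)
        then have "(a \<bullet> z - b) * (a \<bullet> y - b) < 0" unfolding az using e
          by (simp add: mult.assoc mult_pos_pos)
        then obtain c where "y = p + c *\<^sub>R (z - p)" using cross e unfolding z_def by blast
        then have "y = p + (- c * e) *\<^sub>R (x - p)" by (simp add: z_def algebra_simps)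
        then show ?thesis by blast
      qed
    qed
  qed
  have "collinear F" unfolding collinear_alt using line by metis
  then obtain u w where uw: "F = closed_segment u w"
    using compact_convex_collinear_segment[of F] compF cF pinF by blast
  have "u \<noteq> w" using uw \<open>F \<noteq> {p}\<close> pinF by auto
  then have pop: "p \<in> open_segment u w" using pF uw by (simp add: rel_interior_closed_segment)
  have V: "u \<in> vertices P" "w \<in> vertices P"
    using extreme_point_of_face[OF F] uw by (auto simp: vertices_def extreme_point_of_segment)
  have ne: "a \<bullet> u \<noteq> b" "a \<bullet> w \<noteq> b"
    using FH[of u] FH[of w] pop uw by (auto simp: open_segment_def)
  obtain c where c: "0 < c" "c < 1" "p = (1 - c) *\<^sub>R u + c *\<^sub>R w" using pop by (auto simp: in_segment)
  have bal: "(1 - c) * (a \<bullet> u - b) + c * (a \<bullet> w - b) = 0"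
    using pH unfolding c(3) by (simp add: inner_simps algebra_simps)
  show ?thesis
  proof (cases "a \<bullet> u > b")
    case True
    then have "(1 - c) * (a \<bullet> u - b) > 0" using c by simp
    then have "c * (a \<bullet> w - b) < 0" using bal by linarith
    then have "a \<bullet> w < b" using c by (simp add: mult_less_0_iff)
    then show ?thesis using that True V pop F uw by blast
  next
    case False
    then have "(1 - c) * (a \<bullet> u - b) < 0" using c ne by (simp add: mult_less_0_iff)
    then have "c * (a \<bullet> w - b) > 0" using bal by linarith
    then have "a \<bullet> w > b" using c by (simp add: zero_less_mult_iff)
    then show ?thesis using that[of w u] False ne V pop F uw
      by (auto simp: open_segment_commute closed_segment_commute)
  qed
qed

section \<open>The cyclic order of the vertices of a plane slice\<close>

lemma orthogonal_triple_eq_0: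
  fixes a e n y :: "'a::euclidean_space"
  assumes "DIM('a) = 3" "a \<noteq> 0" "e \<noteq> 0" "n \<noteq> 0" "a \<bullet> e = 0" "a \<bullet> n = 0" "e \<bullet> n = 0"
    and "y \<bullet> a = 0" "y \<bullet> e = 0" "y \<bullet> n = 0"
  shows "y = 0"
proof (rule ccontr)
  assume y: "y \<noteq> 0"
  have "a \<noteq> e" "a \<noteq> n" "e \<noteq> n" "y \<noteq> a" "y \<noteq> e" "y \<noteq> n" using assms y by auto
  then have "card {a, e, n, y} = 4" by auto
  moreover have "pairwise orthogonal {a, e, n, y}"
    using assms by (auto simp: pairwise_def orthogonal_def inner_commute)
  then have "independent {a, e, n, y}"
    using assms y by (intro pairwise_orthogonal_independent) auto
  ultimately show False using independent_bound[of "{a, e, n, y}"] assms(1) by auto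
qed

text \<open>
Points \<open>(s, t)\<close> of the plane stand for lines. The hypothesis says that, among the three functionals
\<open>x * s + t\<close>, the middle one is somewhere the largest, so its point is above the chord of the
others.
\<close>

lemma middle_above_chord:
  fixes s1 s2 s3 t1 t2 t3 x :: real
  assumes "s1 < s2" "s2 < s3" "x * s1 + t1 < x * s2 + t2" "x * s3 + t3 < x * s2 + t2"
  obtains c d k where "c > 0" "d > 0" "k > 0" "c + d = 1"
    "s2 = c * s1 + d * s3" "t2 = c * t1 + d * t3 + k"
proof -
  define c where "c = (s3 - s2) / (s3 - s1)"
  define d where "d = (s2 - s1) / (s3 - s1)"
  have pos: "c > 0" "d > 0" using assms by (auto simp: c_def d_def)
  have cd: "c + d = 1" using assms by (simp add: c_def d_def divide_simps)
  have s2: "s2 = c * s1 + d * s3"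
    using assms by (simp add: c_def d_def divide_simps) (simp add: algebra_simps)
  have "c * (x * s1 + t1) + d * (x * s3 + t3) < c * (x * s2 + t2) + d * (x * s2 + t2)"
    by (rule add_strict_mono[OF mult_strict_left_mono[OF assms(3) pos(1)]
          mult_strict_left_mono[OF assms(4) pos(2)]])
  also have "\<dots> = x * s2 + t2" using cd by (simp flip: distrib_right)
  also have "\<dots> = x * (c * s1 + d * s3) + t2" using s2 by simp
  finally have "c * t1 + d * t3 < t2" by (simp add: algebra_simps)
  then show ?thesis using that[of c d "t2 - (c * t1 + d * t3)"] pos cd s2 by simp
qed

text \<open>
The chords 13 and 24 of four points in convex position, sorted by the first coordinate, meet.
Point 2 is \<open>k\<close> above the chord 13, and point 3 is \<open>k'\<close> above the chord 24; weighting the two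
relations by \<open>k'\<close> and \<open>k\<close> cancels the vertical direction.
\<close>

lemma crossing_chords:
  fixes s1 s2 s3 s4 t1 t2 t3 t4 x y :: real
  assumes "s1 < s2" "s2 < s3" "s3 < s4"
    and "x * s1 + t1 < x * s2 + t2" "x * s3 + t3 < x * s2 + t2"
    and "y * s2 + t2 < y * s3 + t3" "y * s4 + t4 < y * s3 + t3"
  obtains \<alpha> \<beta> \<gamma> \<delta> where "\<alpha> > 0" "\<beta> > 0" "\<gamma> > 0" "\<delta> > 0" "\<alpha> + \<beta> = \<gamma> + \<delta>"
    "\<alpha> * s1 + \<beta> * s3 = \<gamma> * s2 + \<delta> * s4" "\<alpha> * t1 + \<beta> * t3 = \<gamma> * t2 + \<delta> * t4"
proof -
  obtain c d k where 1: "c > 0" "d > 0" "k > 0" "c + d = 1"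
    "s2 = c * s1 + d * s3" "t2 = c * t1 + d * t3 + k"
    using middle_above_chord[OF assms(1,2,4,5)] .
  obtain c' d' k' where 2: "c' > 0" "d' > 0" "k' > 0" "c' + d' = 1"
    "s3 = c' * s2 + d' * s4" "t3 = c' * t2 + d' * t4 + k'"
    using middle_above_chord[OF assms(2,3,6,7)] .
  show ?thesis
  proof
    show "k' * c > 0" "k + k' * d > 0" "k' + k * c' > 0" "k * d' > 0"
      using 1 2 by (auto intro: add_pos_pos)
    have "k' * (c + d) + k = k' + k * (c' + d')" using 1 2 by simp
    then show "k' * c + (k + k' * d) = (k' + k * c') + k * d'" by (simp add: algebra_simps)
    have "k' * (c * s1 + d * s3) + k * s3 = k' * s2 + k * (c' * s2 + d' * s4)"
      using 1(5) 2(5) by simp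
    then show "k' * c * s1 + (k + k' * d) * s3 = (k' + k * c') * s2 + k * d' * s4"
      by (simp add: algebra_simps)
    have "k' * (c * t1 + d * t3 + k) + k * t3 = k' * t2 + k * (c' * t2 + d' * t4 + k')"
      using 1(6) 2(6) by simp
    then show "k' * c * t1 + (k + k' * d) * t3 = (k' + k * c') * t2 + k * d' * t4"
      by (simp add: algebra_simps)
  qed
qed

lemma set_subseq: "subseq xs ys \<Longrightarrow> set xs \<subseteq> set ys"
  unfolding subseq_conv_nths using set_nths_subset by metis

lemma sorted_wrt_subseq:
  assumes "subseq xs ys" "sorted_wrt R ys"
  shows "sorted_wrt R xs"
  using assms by (induction rule: list_emb.induct) (auto dest: set_subseq)

lemma sorted_enumeration:
  fixes f :: "'a \<Rightarrow> real"
  assumes "finite A" "inj_on f A"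
  obtains xs where "distinct xs" "set xs = A" "sorted_wrt (\<lambda>x y. f x < f y) xs"
proof -
  define xs where "xs = map (inv_into A f) (sorted_list_of_set (f ` A))"
  have m: "map f xs = sorted_list_of_set (f ` A)"
    unfolding xs_def using assms(1) by (auto intro!: map_idI simp: f_inv_into_f)
  show ?thesis
  proof
    show "distinct xs" using m by (metis distinct_map distinct_sorted_list_of_set)
    show "set xs = A" using assms by (simp add: xs_def)
    have "sorted_wrt (<) (map f xs)" unfolding m by (rule strict_sorted_list_of_set)
    then show "sorted_wrt (\<lambda>x y. f x < f y) xs" by (simp add: sorted_wrt_map)
  qed
qed

text \<open>
Here \<open>g p \<bullet> x \<le> h p\<close> is to be thought of as a half-space whose boundary touches the slice at \<open>p\<close>.
Restricted to the hyperplane \<open>a \<bullet> x = b\<close> these functionals are, up to scaling, the vertices of the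
dual polygon,
and the condition says that its chords \<open>p r\<close> and \<open>q s\<close> cross. The multiple \<open>\<kappa>\<close> of \<open>a \<bullet> x - b\<close> is
what restricting to the hyperplane ignores; its sign is decisive in \<open>noncrossing_labels\<close>.
\<close>

definition chords_cross where
  "chords_cross a b g h p q r s \<longleftrightarrow> (\<exists>\<alpha> \<beta> \<gamma> \<delta> \<kappa> :: real. \<alpha> > 0 \<and> \<beta> > 0 \<and> \<gamma> > 0 \<and> \<delta> > 0 \<and>
     \<alpha> *\<^sub>R g p + \<beta> *\<^sub>R g r - \<gamma> *\<^sub>R g q - \<delta> *\<^sub>R g s = \<kappa> *\<^sub>R a \<and>
     \<alpha> * h p + \<beta> * h r - \<gamma> * h q - \<delta> * h s = \<kappa> * b)"

text \<open>
The points are the vertices of a convex polygon in the plane \<open>a \<bullet> x = b\<close>, with a tangent line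
given at each, and \<open>xs\<close> lists them in cyclic order. To obtain this order without angles, send one
of the points, \<open>p0\<close>, to infinity. The other functionals are scaled to the value \<open>-1\<close> at \<open>p0\<close>; then
each of them is determined on the plane by its slopes \<open>S\<close> and \<open>T\<close> along the tangent direction
\<open>e\<close> at \<open>p0\<close> and along an inward direction \<open>n\<close>. Each of the lines is strictly the highest
one at its own point, so the points \<open>(S, T)\<close> lie on the graph of a concave function and the order
by \<open>S\<close> is the cyclic order. The functional at \<open>p0\<close> is the vertical direction in this picture.
\<close>

lemma tangent_line_cyclic_order:
  fixes a :: "'a::euclidean_space" and g :: "'a \<Rightarrow> 'a" and h :: "'a \<Rightarrow> real"
  assumes dim: "DIM('a) = 3" and a: "a \<noteq> 0" and fin: "finite E"
    and on: "\<And>p. p \<in> E \<Longrightarrow> a \<bullet> p = b"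
    and zero: "\<And>p. p \<in> E \<Longrightarrow> g p \<bullet> p = h p"
    and neg: "\<And>p q. p \<in> E \<Longrightarrow> q \<in> E \<Longrightarrow> p \<noteq> q \<Longrightarrow> g p \<bullet> q < h p"
  shows "\<exists>xs. distinct xs \<and> set xs = E \<and>
    (\<forall>p q r s. subseq [p, q, r, s] xs \<longrightarrow> chords_cross a b g h p q r s)"
proof (cases "card E \<le> 1")
  case True
  obtain xs where xs: "set xs = E" "distinct xs" using finite_distinct_list[OF fin] by blast
  then have "length xs \<le> 1" using True distinct_card by fastforce
  then have "\<not> subseq [p, q, r, s] xs" for p q r s by (intro not_subseq_length) simp
  then show ?thesis using xs by blast
next
  case False
  then obtain p0 p1 where p0: "p0 \<in> E" and p1: "p1 \<in> E" "p1 \<noteq> p0"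
    using fin card_le_Suc0_iff_eq[of E] by auto
  \<comment> \<open>\<open>n0\<close> is the normal of the tangent line at \<open>p0\<close> within the plane.\<close>
  define n0 where "n0 = g p0 - (g p0 \<bullet> a / (a \<bullet> a)) *\<^sub>R a"
  have an0: "a \<bullet> n0 = 0" using a by (simp add: n0_def inner_diff_right inner_commute)
  have n0: "n0 \<noteq> 0"
  proof
    assume "n0 = 0"
    then obtain c where "g p0 = c *\<^sub>R a" unfolding n0_def by auto
    then have "g p0 \<bullet> p1 = g p0 \<bullet> p0" using on p0 p1 by simp
    then show False using neg[OF p0 p1(1)] zero[OF p0] p1 by auto
  qed
  have gn0: "g p0 \<bullet> n0 = n0 \<bullet> n0"
    using an0 by (simp add: n0_def inner_diff_left inner_commute)
  define n where "n = (- 1 / (n0 \<bullet> n0)) *\<^sub>R n0"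
  have n: "n \<noteq> 0" "a \<bullet> n = 0" and gn: "g p0 \<bullet> n = - 1"
    using n0 an0 gn0 by (auto simp: n_def)
  have "dim {a, n0} < DIM('a)"
    using dim_le_card'[of "{a, n0}"] card_insert_le_m1[of 2 "{n0}" a] dim by simp
  then obtain e where e: "e \<noteq> 0" "\<And>y. y \<in> span {a, n0} \<Longrightarrow> orthogonal e y"
    using orthogonal_to_subspace_exists by blast
  have ea: "e \<bullet> a = 0" and en0: "e \<bullet> n0 = 0"
    using e(2)[of a] e(2)[of n0] by (auto simp: orthogonal_def span_base)
  have ae: "a \<bullet> e = 0" and en: "e \<bullet> n = 0" using ea en0 by (auto simp: n_def inner_commute)
  have "g p0 = n0 + (g p0 \<bullet> a / (a \<bullet> a)) *\<^sub>R a" by (simp add: n0_def)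
  then have ge: "g p0 \<bullet> e = 0" using ea en0 by (metis add_0 inner_add_right inner_commute inner_scaleR_right mult_zero_right)
  note kernel = orthogonal_triple_eq_0[OF dim a e(1) n(1) ae n(2) en]
  define lam where "lam p = h p - g p \<bullet> p0" for p
  define S where "S p = g p \<bullet> e / lam p" for p
  define T where "T p = g p \<bullet> n / lam p" for p
  let ?E = "E - {p0}"
  have lam: "lam p > 0" if "p \<in> ?E" for p using neg[of p p0] that p0 by (simp add: lam_def)
  have gS: "g p \<bullet> e = lam p * S p" "g p \<bullet> n = lam p * T p" if "p \<in> ?E" for p
    using lam[OF that] by (auto simp: S_def T_def)
  \<comment> \<open>A point \<open>q = p0 + \<alpha> *\<^sub>R e + \<beta> *\<^sub>R n\<close> of the polygon gets the projective coordinate \<open>x = \<alpha> / \<beta>\<close>.\<close>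
  have peak: "\<exists>x. \<forall>p \<in> ?E. p \<noteq> q \<longrightarrow> x * S p + T p < x * S q + T q" if q: "q \<in> ?E" for q
  proof -
    define \<alpha> where "\<alpha> = (q - p0) \<bullet> e / (e \<bullet> e)"
    define \<beta> where "\<beta> = (q - p0) \<bullet> n / (n \<bullet> n)"
    have "q - p0 - \<alpha> *\<^sub>R e - \<beta> *\<^sub>R n = 0"
    proof (rule kernel)
      show "(q - p0 - \<alpha> *\<^sub>R e - \<beta> *\<^sub>R n) \<bullet> a = 0"
        using on[of q] on[OF p0] q ae n(2)
        by (simp add: inner_diff_right inner_commute[of _ a])
      show "(q - p0 - \<alpha> *\<^sub>R e - \<beta> *\<^sub>R n) \<bullet> e = 0"
        using e(1) en by (simp add: inner_diff_left inner_commute[of n e] \<alpha>_def)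
      show "(q - p0 - \<alpha> *\<^sub>R e - \<beta> *\<^sub>R n) \<bullet> n = 0"
        using n(1) en by (simp add: inner_diff_left \<beta>_def)
    qed
    then have qe: "q = p0 + \<alpha> *\<^sub>R e + \<beta> *\<^sub>R n" by (simp add: algebra_simps)
    have "g p0 \<bullet> q = h p0 - \<beta>" using zero[OF p0] ge gn by (subst qe) (simp add: inner_add_right)
    then have \<beta>: "\<beta> > 0" using neg[of p0 q] p0 q by auto
    have val: "g p \<bullet> q - h p = lam p * (\<alpha> * S p + \<beta> * T p - 1)" if "p \<in> ?E" for p
    proof -
      have "g p \<bullet> q - h p = \<alpha> * (g p \<bullet> e) + \<beta> * (g p \<bullet> n) - lam p"
        by (subst qe) (simp add: inner_add_right lam_def)
      then show ?thesis by (simp add: gS[OF that] algebra_simps)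
    qed
    have one: "\<alpha> * S q + \<beta> * T q = 1" using val[OF q] zero[of q] lam[OF q] q by simp
    have "(\<alpha> / \<beta>) * S p + T p < (\<alpha> / \<beta>) * S q + T q" if p: "p \<in> ?E" "p \<noteq> q" for p
    proof -
      have "lam p * (\<alpha> * S p + \<beta> * T p - 1) < 0" using val[OF p(1)] neg[of p q] p q by simp
      then have "\<alpha> * S p + \<beta> * T p < \<alpha> * S q + \<beta> * T q"
        using lam[OF p(1)] one by (simp add: mult_less_0_iff)
      then have "(\<alpha> * S p + \<beta> * T p) / \<beta> < (\<alpha> * S q + \<beta> * T q) / \<beta>"
        using \<beta> by (rule divide_strict_right_mono)
      then show ?thesis using \<beta> by (simp add: add_divide_distrib)
    qed
    then show ?thesis by blast
  qed
  have "inj_on S ?E"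
  proof (rule inj_onI, rule ccontr)
    fix p q assume pq: "p \<in> ?E" "q \<in> ?E" "S p = S q" "p \<noteq> q"
    obtain x where "x * S p + T p < x * S q + T q" using peak[OF pq(2)] pq by metis
    moreover obtain y where "y * S q + T q < y * S p + T p" using peak[OF pq(1)] pq by metis
    ultimately show False using pq(3) by simp
  qed
  then obtain L where L: "distinct L" "set L = ?E" "sorted_wrt (\<lambda>p q. S p < S q) L"
    using sorted_enumeration[of ?E S] fin by blast
  \<comment> \<open>A functional that vanishes at \<open>p0\<close> and in the directions \<open>e\<close> and \<open>n\<close> vanishes on the plane,
    hence is a multiple of \<open>a \<bullet> x - b\<close>.\<close>
  have relation: "chords_cross a b g h p q r s"
    if pos: "\<alpha> > 0" "\<beta> > 0" "\<gamma> > 0" "\<delta> > 0"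
      and 1: "\<alpha> * lam p + \<beta> * lam r = \<gamma> * lam q + \<delta> * lam s"
      and 2: "\<alpha> * (g p \<bullet> e) + \<beta> * (g r \<bullet> e) = \<gamma> * (g q \<bullet> e) + \<delta> * (g s \<bullet> e)"
      and 3: "\<alpha> * (g p \<bullet> n) + \<beta> * (g r \<bullet> n) = \<gamma> * (g q \<bullet> n) + \<delta> * (g s \<bullet> n)"
    for \<alpha> \<beta> \<gamma> \<delta> p q r s
  proof -
    define G where "G = \<alpha> *\<^sub>R g p + \<beta> *\<^sub>R g r - \<gamma> *\<^sub>R g q - \<delta> *\<^sub>R g s"
    define K where "K = \<alpha> * h p + \<beta> * h r - \<gamma> * h q - \<delta> * h s"
    define \<kappa> where "\<kappa> = G \<bullet> a / (a \<bullet> a)"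
    have "G \<bullet> e = 0" using 2 by (simp add: G_def inner_simps)
    moreover have "G \<bullet> n = 0" using 3 by (simp add: G_def inner_simps)
    moreover have K: "K = G \<bullet> p0" using 1 by (simp add: G_def K_def lam_def inner_simps algebra_simps)
    ultimately have "G - \<kappa> *\<^sub>R a = 0"
      using a ae n(2) by (intro kernel) (auto simp: inner_diff_left \<kappa>_def)
    then have "G = \<kappa> *\<^sub>R a" by simp
    moreover from this have "K = \<kappa> * b" using K on[OF p0] by simp
    ultimately show ?thesis using pos unfolding chords_cross_def G_def K_def by blast
  qed
  show ?thesis
  proof (intro exI[of _ "p0 # L"] conjI allI impI)
    show "distinct (p0 # L)" "set (p0 # L) = E" using L p0 by auto
    fix p q r s assume sub: "subseq [p, q, r, s] (p0 # L)"
    show "chords_cross a b g h p q r s"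
    proof (cases "p = p0")
      case True
      then have sub': "subseq [q, r, s] L" using sub by simp
      then have in': "q \<in> ?E" "r \<in> ?E" "s \<in> ?E" using L(2) set_subseq[OF sub'] by auto
      have ord: "S q < S r" "S r < S s" using sorted_wrt_subseq[OF sub' L(3)] by auto
      obtain x where x: "x * S q + T q < x * S r + T r" "x * S s + T s < x * S r + T r"
        using peak[OF in'(2)] in' ord by (metis less_irrefl)
      obtain c d k where ck: "c > 0" "d > 0" "k > 0" "c + d = 1"
        "S r = c * S q + d * S s" "T r = c * T q + d * T s + k"
        using middle_above_chord[OF ord x] .
      show ?thesis
        by (rule relation[of k "1 / lam r" "c / lam q" "d / lam s"])
          (use ck lam[OF in'(1)] lam[OF in'(2)] lam[OF in'(3)] True ge gn zero[OF p0] in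
            \<open>simp_all add: gS[OF in'(1)] gS[OF in'(2)] gS[OF in'(3)] lam_def[of p0]\<close>)
    next
      case False
      then have sub': "subseq [p, q, r, s] L" using sub by simp
      then have in': "p \<in> ?E" "q \<in> ?E" "r \<in> ?E" "s \<in> ?E" using L(2) set_subseq[OF sub'] by auto
      have ord: "S p < S q" "S q < S r" "S r < S s" using sorted_wrt_subseq[OF sub' L(3)] by auto
      obtain x where x: "x * S p + T p < x * S q + T q" "x * S r + T r < x * S q + T q"
        using peak[OF in'(2)] in' ord by (metis less_irrefl)
      obtain y where y: "y * S q + T q < y * S r + T r" "y * S s + T s < y * S r + T r"
        using peak[OF in'(3)] in' ord by (metis less_irrefl)
      obtain \<alpha> \<beta> \<gamma> \<delta> where co: "\<alpha> > 0" "\<beta> > 0" "\<gamma> > 0" "\<delta> > 0" "\<alpha> + \<beta> = \<gamma> + \<delta>"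
        "\<alpha> * S p + \<beta> * S r = \<gamma> * S q + \<delta> * S s" "\<alpha> * T p + \<beta> * T r = \<gamma> * T q + \<delta> * T s"
        using crossing_chords[OF ord x y] .
      show ?thesis
        by (rule relation[of "\<alpha> / lam p" "\<beta> / lam r" "\<gamma> / lam q" "\<delta> / lam s"])
          (use co lam[OF in'(1)] lam[OF in'(2)] lam[OF in'(3)] lam[OF in'(4)] in
            \<open>simp_all add: gS[OF in'(1)] gS[OF in'(2)] gS[OF in'(3)] gS[OF in'(4)]\<close>)
    qed
  qed
qed

text \<open>
Suppose that the labels alternate as \<open>x, y, x, y\<close> at \<open>p, q, r, s\<close>. Evaluate the relation of the
crossing chords at \<open>x\<close>: the functionals of \<open>p\<close> and \<open>r\<close> vanish there and those of \<open>q\<close> and \<open>s\<close> are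
negative, so \<open>\<kappa> * (a \<bullet> x - b) > 0\<close>. At \<open>y\<close> the roles are exchanged and the sign is the opposite
one. But \<open>x\<close> and \<open>y\<close> are on the same side of the hyperplane. The sign \<open>\<sigma>\<close> stands for this side.
\<close>

lemma noncrossing_labels:
  fixes a :: "'a::euclidean_space"
  assumes cross: "\<And>p q r s. subseq [p, q, r, s] xs \<Longrightarrow> chords_cross a b g h p q r s"
    and zero: "\<And>p. p \<in> set xs \<Longrightarrow> g p \<bullet> u p = h p"
    and neg: "\<And>p q. p \<in> set xs \<Longrightarrow> q \<in> set xs \<Longrightarrow> u q \<noteq> u p \<Longrightarrow> g p \<bullet> u q < h p"
    and side: "\<And>p. p \<in> set xs \<Longrightarrow> \<sigma> * (a \<bullet> u p - b) > 0"
  shows "noncrossing (map u xs)"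
  unfolding noncrossing_def
proof (intro allI impI notI)
  fix x y assume xy: "x \<noteq> y" and "subseq [x, y, x, y] (map u xs)"
  then obtain N where N: "[x, y, x, y] = map u (nths xs N)"
    by (metis subseq_conv_nths nths_map)
  then have "\<exists>p q r s. nths xs N = [p, q, r, s] \<and> u p = x \<and> u q = y \<and> u r = x \<and> u s = y"
    by (auto simp: Cons_eq_map_conv)
  then obtain p q r s where pqrs: "nths xs N = [p, q, r, s]"
    and ux: "u p = x" "u q = y" "u r = x" "u s = y" by blast
  have sub: "subseq [p, q, r, s] xs" using pqrs subseq_conv_nths by metis
  then have mem: "p \<in> set xs" "q \<in> set xs" "r \<in> set xs" "s \<in> set xs"
    using set_subseq[OF sub] by auto
  obtain \<alpha> \<beta> \<gamma> \<delta> \<kappa> where pos: "\<alpha> > 0" "\<beta> > 0" "\<gamma> > 0" "\<delta> > 0"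
    and 1: "\<alpha> *\<^sub>R g p + \<beta> *\<^sub>R g r - \<gamma> *\<^sub>R g q - \<delta> *\<^sub>R g s = \<kappa> *\<^sub>R a"
    and 2: "\<alpha> * h p + \<beta> * h r - \<gamma> * h q - \<delta> * h s = \<kappa> * b"
    using cross[OF sub] unfolding chords_cross_def by blast
  have ev: "\<alpha> * (g p \<bullet> z - h p) + \<beta> * (g r \<bullet> z - h r) - \<gamma> * (g q \<bullet> z - h q) - \<delta> * (g s \<bullet> z - h s)
      = \<kappa> * (a \<bullet> z - b)" for z
  proof -
    have "(\<alpha> *\<^sub>R g p + \<beta> *\<^sub>R g r - \<gamma> *\<^sub>R g q - \<delta> *\<^sub>R g s) \<bullet> z = \<kappa> * (a \<bullet> z)" using 1 by simp
    with 2 show ?thesis by (simp add: inner_simps algebra_simps)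
  qed
  have "\<gamma> * (g q \<bullet> x - h q) < 0" "\<delta> * (g s \<bullet> x - h s) < 0"
    using neg[OF mem(2,1)] neg[OF mem(4,1)] pos ux xy by (simp_all add: mult_less_0_iff)
  then have kx: "\<kappa> * (a \<bullet> x - b) > 0"
    using ev[of x] zero[OF mem(1)] zero[OF mem(3)] ux by simp
  have "\<alpha> * (g p \<bullet> y - h p) < 0" "\<beta> * (g r \<bullet> y - h r) < 0"
    using neg[OF mem(1,2)] neg[OF mem(3,2)] pos ux xy by (simp_all add: mult_less_0_iff)
  then have ky: "\<kappa> * (a \<bullet> y - b) < 0"
    using ev[of y] zero[OF mem(2)] zero[OF mem(4)] ux by simp
  show False
    using kx ky side[OF mem(1)] side[OF mem(2)] ux by (auto simp: zero_less_mult_iff mult_less_0_iff)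
qed

section \<open>Upper bounds\<close>

lemma finite_vertices: "polytope P \<Longrightarrow> finite (vertices P)"
  unfolding vertices_def using finite_polyhedron_extreme_points polytope_imp_polyhedron by blast

lemma vertices_subset: "vertices P \<subseteq> P"
  by (auto simp: vertices_def extreme_point_of_def)

lemma open_segment_level_unique:
  fixes a :: "'a::real_inner"
  assumes "p \<in> open_segment u w" "q \<in> closed_segment u w" "a \<bullet> p = b" "a \<bullet> q = b" "a \<bullet> u \<noteq> b"
  shows "p = q"
proof -
  obtain c where c: "p = (1 - c) *\<^sub>R u + c *\<^sub>R w" using assms by (auto simp: in_segment)
  obtain d where d: "q = (1 - d) *\<^sub>R u + d *\<^sub>R w" using assms by (auto simp: in_segment)
  have "(a \<bullet> u - b) + c * (a \<bullet> w - a \<bullet> u) = 0" "(a \<bullet> u - b) + d * (a \<bullet> w - a \<bullet> u) = 0"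
    using assms(3,4) by (auto simp: c d inner_simps algebra_simps)
  then have "(c - d) * (a \<bullet> w - a \<bullet> u) = 0" "a \<bullet> w \<noteq> a \<bullet> u" using assms(5) by (auto simp: algebra_simps)
  then have "c = d" by simp
  then show ?thesis using c d by simp
qed

text \<open>
The functions record, for every vertex \<open>p\<close> of the slice that is no vertex of \<open>P\<close>, the upper end
\<open>u p\<close> and the lower end \<open>w p\<close> of the edge through \<open>p\<close>, and a supporting half-space of \<open>P\<close> that
meets \<open>P\<close> exactly in this edge.
\<close>

lemma slice_edges:
  fixes P :: "'a::euclidean_space set"
  assumes P: "polytope P" and E: "E = vertices ({x. a \<bullet> x = b} \<inter> P) - vertices P"
  shows "\<exists>u w g h. \<forall>p \<in> E. (u p \<in> vertices P \<and> b < a \<bullet> u p) \<and> (w p \<in> vertices P \<and> a \<bullet> w p < b)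
    \<and> p \<in> open_segment (u p) (w p)
    \<and> (\<forall>x \<in> P. g p \<bullet> x \<le> h p \<and> (g p \<bullet> x = h p \<longleftrightarrow> x \<in> closed_segment (u p) (w p)))"
proof -
  have "\<forall>p \<in> E. \<exists>u w g h. (u \<in> vertices P \<and> b < a \<bullet> u) \<and> (w \<in> vertices P \<and> a \<bullet> w < b)
      \<and> p \<in> open_segment u w
      \<and> (\<forall>x \<in> P. g \<bullet> x \<le> h \<and> (g \<bullet> x = h \<longleftrightarrow> x \<in> closed_segment u w))"
  proof
    fix p assume "p \<in> E"
    then have "p extreme_point_of ({x. a \<bullet> x = b} \<inter> P)" "p \<notin> vertices P"
      using E by (auto simp: vertices_def)
    then obtain u w where uw: "u \<in> vertices P" "w \<in> vertices P" "a \<bullet> u > b" "a \<bullet> w < b"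
      "p \<in> open_segment u w" "closed_segment u w face_of P"
      using slice_vertex_cases[OF P] by metis
    then have "closed_segment u w exposed_face_of P"
      using exposed_face_of_polyhedron[OF polytope_imp_polyhedron[OF P]] by blast
    then obtain g h where "P \<subseteq> {x. g \<bullet> x \<le> h}" "closed_segment u w = P \<inter> {x. g \<bullet> x = h}"
      unfolding exposed_face_of_def by blast
    then have "\<forall>x \<in> P. g \<bullet> x \<le> h \<and> (g \<bullet> x = h \<longleftrightarrow> x \<in> closed_segment u w)" by auto
    then show "\<exists>u w g h. (u \<in> vertices P \<and> b < a \<bullet> u) \<and> (w \<in> vertices P \<and> a \<bullet> w < b)
      \<and> p \<in> open_segment u w
      \<and> (\<forall>x \<in> P. g \<bullet> x \<le> h \<and> (g \<bullet> x = h \<longleftrightarrow> x \<in> closed_segment u w))"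
      using uw by blast
  qed
  then show ?thesis unfolding bchoice_iff .
qed

lemma card_slice_edges_le_product:
  fixes P :: "'a::euclidean_space set"
  assumes P: "polytope P" and E: "E = vertices ({x. a \<bullet> x = b} \<inter> P) - vertices P"
  shows "finite E \<and> card E \<le> card {v \<in> vertices P. a \<bullet> v > b} * card {v \<in> vertices P. a \<bullet> v < b}"
    (is "_ \<and> _ \<le> card ?A * card ?B")
proof -
  obtain u w g h where D: "\<forall>p \<in> E. (u p \<in> vertices P \<and> b < a \<bullet> u p) \<and> (w p \<in> vertices P \<and> a \<bullet> w p < b)
    \<and> p \<in> open_segment (u p) (w p)
    \<and> (\<forall>x \<in> P. g p \<bullet> x \<le> h p \<and> (g p \<bullet> x = h p \<longleftrightarrow> x \<in> closed_segment (u p) (w p)))"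
    using slice_edges[OF P E] by blast
  then have
    u: "\<And>p. p \<in> E \<Longrightarrow> u p \<in> vertices P \<and> b < a \<bullet> u p" and
    w: "\<And>p. p \<in> E \<Longrightarrow> w p \<in> vertices P \<and> a \<bullet> w p < b" and
    seg: "\<And>p. p \<in> E \<Longrightarrow> p \<in> open_segment (u p) (w p)"
    by blast+
  have on: "a \<bullet> p = b" if "p \<in> E" for p
    using that E vertices_subset[of "{x. a \<bullet> x = b} \<inter> P"] by auto
  have inj: "inj_on (\<lambda>p. (u p, w p)) E"
  proof (rule inj_onI)
    fix p q assume pq: "p \<in> E" "q \<in> E" "(u p, w p) = (u q, w q)"
    show "p = q"
      by (rule open_segment_level_unique[of p "u p" "w p" q a b])
        (use pq seg[of p] seg[of q] on u[of p] open_closed_segment in auto)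
  qed
  have img: "(\<lambda>p. (u p, w p)) ` E \<subseteq> ?A \<times> ?B" using u w by auto
  have fin: "finite (?A \<times> ?B)" using finite_vertices[OF P] by auto
  show ?thesis
    using inj_on_finite[OF inj img fin] card_inj_on_le[OF inj img fin] by (simp add: card_cartesian_product)
qed

text \<open>
Every label \<open>u q\<close> other than \<open>u p\<close> lies off the edge through \<open>p\<close>, so the supporting functional at \<open>p\<close> is
negative there; the same holds for the lower ends. Hence both label sequences are noncrossing in
the cyclic order of the slice vertices.
\<close>

lemma card_slice_edges_le_planar:
  fixes P :: "'a::euclidean_space set"
  assumes dim: "DIM('a) = 3" and a: "a \<noteq> 0"
    and P: "polytope P" and E: "E = vertices ({x. a \<bullet> x = b} \<inter> P) - vertices P"
    and two: "card E \<ge> 2"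
  shows "card E + 4 \<le> 2 * (card {v \<in> vertices P. a \<bullet> v > b} + card {v \<in> vertices P. a \<bullet> v < b})"
    (is "_ \<le> 2 * (card ?A + card ?B)")
proof -
  obtain u w g h where D: "\<forall>p \<in> E. (u p \<in> vertices P \<and> b < a \<bullet> u p) \<and> (w p \<in> vertices P \<and> a \<bullet> w p < b)
    \<and> p \<in> open_segment (u p) (w p)
    \<and> (\<forall>x \<in> P. g p \<bullet> x \<le> h p \<and> (g p \<bullet> x = h p \<longleftrightarrow> x \<in> closed_segment (u p) (w p)))"
    using slice_edges[OF P E] by blast
  then have
    u: "\<And>p. p \<in> E \<Longrightarrow> u p \<in> vertices P \<and> b < a \<bullet> u p" and
    w: "\<And>p. p \<in> E \<Longrightarrow> w p \<in> vertices P \<and> a \<bullet> w p < b" and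
    seg: "\<And>p. p \<in> E \<Longrightarrow> p \<in> open_segment (u p) (w p)" and
    le: "\<And>p x. p \<in> E \<Longrightarrow> x \<in> P \<Longrightarrow> g p \<bullet> x \<le> h p" and
    eq: "\<And>p x. p \<in> E \<Longrightarrow> x \<in> P \<Longrightarrow> g p \<bullet> x = h p \<longleftrightarrow> x \<in> closed_segment (u p) (w p)"
    by blast+
  have on: "a \<bullet> p = b" and EP: "p \<in> P" if "p \<in> E" for p
    using that E vertices_subset[of "{x. a \<bullet> x = b} \<inter> P"] by auto
  have VP: "v \<in> P" if "v \<in> vertices P" for v using that vertices_subset by auto
  have unique: "p = q" if "p \<in> E" "q \<in> E" "q \<in> closed_segment (u p) (w p)" for p q
    by (rule open_segment_level_unique[of p "u p" "w p" q a b])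
      (use that seg[of p] on u[of p] in auto)
  have inj: "inj_on (\<lambda>p. (u p, w p)) E"
  proof (rule inj_onI)
    fix p q assume pq: "p \<in> E" "q \<in> E" "(u p, w p) = (u q, w q)"
    then show "p = q" using unique[of p q] seg[of q] open_closed_segment by auto
  qed
  have ends: "v = u p \<or> v = w p" if "p \<in> E" "v \<in> vertices P" "v \<in> closed_segment (u p) (w p)" for p v
  proof -
    have "v extreme_point_of P" using that(2) by (simp add: vertices_def)
    then have "v \<notin> open_segment (u p) (w p)"
      using VP u[OF that(1)] w[OF that(1)] unfolding extreme_point_of_def by blast
    then show ?thesis using that by (auto simp: open_segment_def)
  qed
  have finE: "finite E" using card_slice_edges_le_product[OF P E] by blast
  have negE: "g p \<bullet> q < h p" if "p \<in> E" "q \<in> E" "p \<noteq> q" for p q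
    using le[of p q] eq[of p q] unique[of p q] that EP by fastforce
  have zeroE: "g p \<bullet> p = h p" if "p \<in> E" for p
    using eq[of p p] that EP seg open_closed_segment by blast
  obtain xs where xs: "distinct xs" "set xs = E"
    and cross: "\<And>p q r s. subseq [p, q, r, s] xs \<Longrightarrow> chords_cross a b g h p q r s"
    using tangent_line_cyclic_order[OF dim a finE, of b g h] on zeroE negE by blast
  have negu: "g p \<bullet> u q < h p" if "p \<in> E" "q \<in> E" "u q \<noteq> u p" for p q
  proof -
    have "u q \<notin> closed_segment (u p) (w p)"
      using ends[of p "u q"] that u[OF that(2)] w[OF that(1)] by force
    then show ?thesis using le[of p "u q"] eq[of p "u q"] that u VP by fastforce
  qed
  have negw: "g p \<bullet> w q < h p" if "p \<in> E" "q \<in> E" "w q \<noteq> w p" for p q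
  proof -
    have "w q \<notin> closed_segment (u p) (w p)"
      using ends[of p "w q"] that w[OF that(2)] u[OF that(1)] by force
    then show ?thesis using le[of p "w q"] eq[of p "w q"] that w VP by fastforce
  qed
  have "noncrossing (map u xs)"
  proof (rule noncrossing_labels[OF cross, where u = u and \<sigma> = 1], simp, unfold xs(2))
    show "g p \<bullet> u p = h p" if "p \<in> E" for p using eq[OF that, of "u p"] u[OF that] VP by simp
    show "0 < 1 * (a \<bullet> u p - b)" if "p \<in> E" for p using u[OF that] by simp
  qed (rule negu)
  moreover have "noncrossing (map w xs)"
  proof (rule noncrossing_labels[OF cross, where u = w and \<sigma> = "-1"], simp, unfold xs(2))
    show "g p \<bullet> w p = h p" if "p \<in> E" for p using eq[OF that, of "w p"] w[OF that] VP by simp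
    show "0 < - 1 * (a \<bullet> w p - b)" if "p \<in> E" for p using w[OF that] by simp
  qed (rule negw)
  moreover have "length xs = card E" using xs distinct_card by fastforce
  moreover have "finite ?A" "finite ?B" using finite_vertices[OF P] by auto
  moreover have "u ` set xs \<subseteq> ?A" "w ` set xs \<subseteq> ?B" using xs u w by auto
  ultimately show ?thesis
    using length_noncrossing_pairs_le[of u xs w ?A ?B] xs inj two by simp
qed

lemma card_vertices_split:
  fixes a :: "'a::euclidean_space"
  assumes "polytope P"
  shows "card (vertices P) = card {v \<in> vertices P. a \<bullet> v > b} + card {v \<in> vertices P. a \<bullet> v < b}
    + card {v \<in> vertices P. a \<bullet> v = b}"
proof -
  have f: "finite (vertices P)" by (rule finite_vertices[OF assms])
  have "vertices P = ({v \<in> vertices P. a \<bullet> v > b} \<union> {v \<in> vertices P. a \<bullet> v < b}) \<union> {v \<in> vertices P. a \<bullet> v = b}"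
    by auto
  then have "card (vertices P) = card (({v \<in> vertices P. a \<bullet> v > b} \<union> {v \<in> vertices P. a \<bullet> v < b})
      \<union> {v \<in> vertices P. a \<bullet> v = b})" by simp
  also have "\<dots> = card {v \<in> vertices P. a \<bullet> v > b} + card {v \<in> vertices P. a \<bullet> v < b}
    + card {v \<in> vertices P. a \<bullet> v = b}"
    using f by (subst card_Un_disjoint, auto)+
  finally show ?thesis .
qed

lemma cv_le_edges_plus_vertices:
  fixes P :: "'a::euclidean_space set"
  assumes P: "polytope P"
  shows "cv P {x. a \<bullet> x = b} \<le> card (vertices ({x. a \<bullet> x = b} \<inter> P) - vertices P)
    + card {v \<in> vertices P. a \<bullet> v = b}"
proof -
  let ?S = "vertices ({x. a \<bullet> x = b} \<inter> P)"
  have fin: "finite (?S - vertices P)" "finite {v \<in> vertices P. a \<bullet> v = b}"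
    using card_slice_edges_le_product[OF P refl] finite_vertices[OF P] by auto
  have "?S \<subseteq> (?S - vertices P) \<union> {v \<in> vertices P. a \<bullet> v = b}"
    using vertices_subset[of "{x. a \<bullet> x = b} \<inter> P"] by auto
  then have "card ?S \<le> card ((?S - vertices P) \<union> {v \<in> vertices P. a \<bullet> v = b})"
    using fin by (intro card_mono) auto
  also have "\<dots> \<le> card (?S - vertices P) + card {v \<in> vertices P. a \<bullet> v = b}" by (rule card_Un_le)
  finally show ?thesis unfolding cv_def .
qed

lemma product_le_balanced:
  fixes x y :: nat
  shows "x * y \<le> (x + y) div 2 * (x + y - (x + y) div 2)"
proof -
  define m where "m = (x + y) div 2"
  have "x + y = 2 * m \<or> x + y = 2 * m + 1" unfolding m_def by linarith
  then show ?thesis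
  proof
    assume xy: "x + y = 2 * m"
    then have y: "int y = 2 * int m - int x" by linarith
    have "int m * int m - int x * int y = (int x - int m) * (int x - int m)"
      unfolding y by (simp add: algebra_simps)
    also have "\<dots> \<ge> 0" by (rule zero_le_square)
    finally have "int (x * y) \<le> int (m * m)" by simp
    then have "x * y \<le> m * m" by (simp only: of_nat_le_iff)
    then show ?thesis unfolding m_def[symmetric] using xy by simp
  next
    assume xy: "x + y = 2 * m + 1"
    then have y: "int y = 2 * int m + 1 - int x" by linarith
    have "int m * (int m + 1) - int x * int y = (int x - int m) * (int x - int m - 1)"
      unfolding y by (simp add: algebra_simps)
    moreover have "(int x - int m) * (int x - int m - 1) \<ge> 0"
      by (cases "int x \<le> int m") (auto simp: zero_le_mult_iff)
    ultimately have "int x * int y \<le> int m * (int m + 1)" by linarith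
    then have "int (x * y) \<le> int (m * (m + 1))" by (simp add: algebra_simps)
    moreover have "x + y - m = m + 1" using xy by simp
    ultimately show ?thesis unfolding m_def[symmetric] by (simp only: of_nat_le_iff)
  qed
qed

text \<open>
The numbers \<open>x\<close>, \<open>y\<close>, \<open>z\<close> count the vertices above, below and on a hyperplane. Shifting the vertices on the
hyperplane to one side costs nothing, provided that the other side is not empty; if one side
is empty, the bound is at least the number of all vertices, since there are 4 or more.
\<close>

lemma product_plus_le_balanced:
  fixes x y z :: nat
  assumes "x + y + z \<ge> 4"
  shows "x * y + z \<le> (x + y + z) div 2 * (x + y + z - (x + y + z) div 2)"
proof (cases "x = 0 \<or> y = 0")
  case True
  have "2 + (x + y + z - 2) = x + y + z" using assms by simp
  then have "2 * (x + y + z - 2) \<le> (x + y + z) div 2 * (x + y + z - (x + y + z) div 2)"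
    using product_le_balanced[of 2 "x + y + z - 2"] by simp
  moreover have "x * y + z \<le> 2 * (x + y + z - 2)" using True assms by auto
  ultimately show ?thesis by (rule order_trans[rotated])
next
  case False
  have "z \<le> z * y" using False by simp
  then have "x * y + z \<le> (x + z) * y" by (simp add: add_mult_distrib)
  also have "\<dots> \<le> (x + z + y) div 2 * (x + z + y - (x + z + y) div 2)" by (rule product_le_balanced)
  finally show ?thesis by (simp add: ac_simps)
qed

lemma cv_le_balanced:
  fixes P :: "'a::euclidean_space set"
  assumes P: "polytope P" and n: "card (vertices P) = n" "n \<ge> 4"
  shows "cv P {x. a \<bullet> x = b} \<le> n div 2 * (n - n div 2)"
proof -
  let ?A = "{v \<in> vertices P. a \<bullet> v > b}" and ?B = "{v \<in> vertices P. a \<bullet> v < b}"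
    and ?Z = "{v \<in> vertices P. a \<bullet> v = b}"
  have split: "n = card ?A + card ?B + card ?Z" using card_vertices_split[OF P] n(1) by metis
  have "cv P {x. a \<bullet> x = b} \<le> card ?A * card ?B + card ?Z"
    using cv_le_edges_plus_vertices[OF P, where a = a and b = b]
      card_slice_edges_le_product[OF P refl, where a = a and b = b] by linarith
  also have "\<dots> \<le> n div 2 * (n - n div 2)"
    using product_plus_le_balanced n(2) unfolding split by blast
  finally show ?thesis .
qed

lemma cv_le_planar:
  fixes P :: "'a::euclidean_space set"
  assumes dim: "DIM('a) = 3" and a: "a \<noteq> 0"
    and P: "polytope P" and n: "card (vertices P) = n" "n \<ge> 4"
  shows "cv P {x. a \<bullet> x = b} \<le> 2 * (n - 2)"
proof -
  let ?E = "vertices ({x. a \<bullet> x = b} \<inter> P) - vertices P"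
  let ?A = "{v \<in> vertices P. a \<bullet> v > b}" and ?B = "{v \<in> vertices P. a \<bullet> v < b}"
    and ?Z = "{v \<in> vertices P. a \<bullet> v = b}"
  note cv = cv_le_edges_plus_vertices[OF P, where a = a and b = b] and split = card_vertices_split[OF P, where a = a and b = b]
  consider "card ?E = 0" | "card ?E = 1" | "card ?E \<ge> 2" by linarith
  then show ?thesis
  proof cases
    case 1
    then show ?thesis using cv split n by linarith
  next
    case 2
    then have "card ?A * card ?B \<noteq> 0" using card_slice_edges_le_product[OF P refl, where a = a and b = b] by linarith
    then have "card ?A \<ge> 1" "card ?B \<ge> 1" by (auto simp: Suc_le_eq card_gt_0_iff)
    then show ?thesis using 2 cv split n by linarith
  next
    case 3
    then show ?thesis using card_slice_edges_le_planar[OF dim a P refl 3] cv split n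
      unfolding distrib_left by linarith
  qed
qed

section \<open>Lower bounds from edges\<close>

text \<open>
An edge from one side to the other meets the hyperplane in one point, which is a face of the slice.
Two edges give different points: an edge that meets the relative interior of another one
contains both ends of it.
\<close>

lemma card_edges_le_cv:
  fixes P :: "'a::euclidean_space set"
  assumes P: "polytope P"
    and I: "\<And>u w. (u, w) \<in> I \<Longrightarrow> closed_segment u w face_of P \<and> a \<bullet> u > b \<and> a \<bullet> w < b"
  shows "card I \<le> cv P {x. a \<bullet> x = b}"
proof -
  let ?H = "{x. a \<bullet> x = b}"
  have "\<exists>p. p \<in> open_segment (fst e) (snd e) \<and> a \<bullet> p = b" if e: "e \<in> I" for e
  proof -
    have d: "a \<bullet> fst e > b" "a \<bullet> snd e < b" using I[of "fst e" "snd e"] e by auto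
    define c where "c = (a \<bullet> fst e - b) / (a \<bullet> fst e - a \<bullet> snd e)"
    have c: "0 < c" "c < 1" using d by (auto simp: c_def divide_simps)
    have "c * (a \<bullet> fst e - a \<bullet> snd e) = a \<bullet> fst e - b" using d by (simp add: c_def)
    then have "a \<bullet> ((1 - c) *\<^sub>R fst e + c *\<^sub>R snd e) = b" by (simp add: inner_simps algebra_simps)
    moreover have "(1 - c) *\<^sub>R fst e + c *\<^sub>R snd e \<in> open_segment (fst e) (snd e)"
      using c d by (auto simp: in_segment)
    ultimately show ?thesis by blast
  qed
  then obtain p where p: "\<And>e. e \<in> I \<Longrightarrow> p e \<in> open_segment (fst e) (snd e)" "\<And>e. e \<in> I \<Longrightarrow> a \<bullet> p e = b"
    by metis
  have "p e \<in> vertices (?H \<inter> P)" if e: "e \<in> I" for e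
  proof -
    have F: "closed_segment (fst e) (snd e) face_of P" "a \<bullet> fst e > b"
      using I[of "fst e" "snd e"] e by auto
    have "(closed_segment (fst e) (snd e) \<inter> ?H) face_of (P \<inter> ?H)"
      by (rule face_of_slice[OF F(1) convex_hyperplane])
    moreover have "closed_segment (fst e) (snd e) \<inter> ?H = {p e}"
    proof (intro equalityI subsetI)
      fix x assume x: "x \<in> closed_segment (fst e) (snd e) \<inter> ?H"
      have "p e = x"
        by (rule open_segment_level_unique[OF p(1)[OF e], of x a b]) (use x p(2)[OF e] F(2) in auto)
      then show "x \<in> {p e}" by simp
    qed (use p[OF e] open_closed_segment in auto)
    ultimately show ?thesis by (simp add: vertices_def face_of_singleton Int_commute)
  qed
  then have img: "p ` I \<subseteq> vertices (?H \<inter> P)" by blast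
  have inj: "inj_on p I"
  proof (rule inj_onI)
    fix e e' assume e: "e \<in> I" "e' \<in> I" "p e = p e'"
    have F: "closed_segment (fst e) (snd e) face_of P" "a \<bullet> fst e > b" "a \<bullet> snd e < b"
      and F': "closed_segment (fst e') (snd e') face_of P" "a \<bullet> fst e' > b" "a \<bullet> snd e' < b"
      using I[of "fst e" "snd e"] I[of "fst e'" "snd e'"] e by auto
    have end': "v extreme_point_of P" if "v = fst e' \<or> v = snd e'" for v
      using extreme_point_of_face[OF F'(1), of v] that by (auto simp: extreme_point_of_segment)
    have "p e \<in> closed_segment (fst e) (snd e)" using p(1)[OF e(1)] open_closed_segment by blast
    then have "fst e' \<in> closed_segment (fst e) (snd e) \<and> snd e' \<in> closed_segment (fst e) (snd e)"
      using face_ofD[OF F(1), of "p e" "fst e'" "snd e'"] p(1)[OF e(2)] e(3) end'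
      by (auto simp: extreme_point_of_def)
    then have "fst e' \<in> {fst e, snd e}" "snd e' \<in> {fst e, snd e}"
      using extreme_point_of_face[OF F(1)] end' by (auto simp: extreme_point_of_segment)
    then show "e = e'" using F F' by (auto simp: prod_eq_iff)
  qed
  have "polytope (?H \<inter> P)"
    using polytope_Int_polyhedron[OF P polyhedron_hyperplane] by (simp add: Int_commute)
  then show ?thesis
    using card_inj_on_le[OF inj img] finite_vertices unfolding cv_def by blast
qed

section \<open>Cyclic polytopes\<close>

text \<open>
The part of the hull in a supporting hyperplane is a face, and a face of a hull is spanned by
some of the generators, which then have to lie in the hyperplane.
\<close>

lemma face_of_convex_hull_supporting:
  fixes S :: "'a::euclidean_space set"
  assumes fin: "finite S" and ge: "\<And>x. x \<in> S \<Longrightarrow> a \<bullet> x \<ge> b"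
  shows "(convex hull {x \<in> S. a \<bullet> x = b}) face_of (convex hull S)"
proof -
  let ?F = "convex hull S \<inter> {x. a \<bullet> x = b}"
  have "convex hull S \<subseteq> {x. a \<bullet> x \<ge> b}"
    using ge by (intro hull_minimal) (auto simp: convex_halfspace_ge)
  then have F: "?F face_of convex hull S"
    by (intro face_of_Int_supporting_hyperplane_ge) auto
  then obtain S' where S': "S' \<subseteq> S" "?F = convex hull S'"
    using face_of_convex_hull_subset[OF finite_imp_compact[OF fin]] by metis
  have "S' \<subseteq> ?F" using S' hull_subset by fast
  then have "S' \<subseteq> {x \<in> S. a \<bullet> x = b}" using S'(1) by blast
  then have "?F \<subseteq> convex hull {x \<in> S. a \<bullet> x = b}" unfolding S'(2) by (rule hull_mono)
  moreover have "convex hull {x \<in> S. a \<bullet> x = b} \<subseteq> ?F"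
    by (intro hull_minimal) (auto simp: convex_Int convex_hyperplane hull_inc)
  ultimately show ?thesis using F by (metis subset_antisym)
qed

text \<open>
The constant coefficient is left out: as an affine functional on the curve, \<open>q\<close> is this linear
part plus \<open>coeff q 0\<close>.
\<close>

definition coeff_vector :: "('d::finite \<Rightarrow> nat) \<Rightarrow> real poly \<Rightarrow> real ^ 'd" where
  "coeff_vector idx q = (\<chi> i. coeff q (idx i))"

lemma poly_conv_moment_curve:
  fixes idx :: "'d::finite \<Rightarrow> nat"
  assumes idx: "bij_betw idx UNIV {1..CARD('d)}" and deg: "degree q \<le> CARD('d)"
  shows "poly q s = coeff q 0 + coeff_vector idx q \<bullet> moment_curve idx s"
proof -
  have "poly q s = poly (\<Sum>i\<le>CARD('d). monom (coeff q i) i) s"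
    using poly_as_sum_of_monoms'[OF deg] by simp
  also have "\<dots> = (\<Sum>i\<le>CARD('d). coeff q i * s ^ i)" by (simp add: poly_sum poly_monom)
  also have "\<dots> = coeff q 0 + (\<Sum>i\<in>{1..CARD('d)}. coeff q i * s ^ i)"
    by (simp add: sum.atMost_shift sum.atLeast1_atMost_eq)
  also have "(\<Sum>i\<in>{1..CARD('d)}. coeff q i * s ^ i) = (\<Sum>i\<in>UNIV. coeff q (idx i) * s ^ idx i)"
    by (rule sum.reindex_bij_betw[OF idx, symmetric])
  also have "\<dots> = coeff_vector idx q \<bullet> moment_curve idx s"
    by (simp add: inner_vec_def coeff_vector_def moment_curve_def)
  finally show ?thesis .
qed

context
  fixes idx :: "'d::finite \<Rightarrow> nat" and n :: nat and t :: "nat \<Rightarrow> real"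
  assumes idx: "bij_betw idx UNIV {1..CARD('d)}"
    and t: "strict_mono_on {1..n} t"
begin

lemma inj_moment_points: "inj_on (\<lambda>k. moment_curve idx (t k)) {1..n}"
proof (rule inj_onI)
  fix k l assume kl: "k \<in> {1..n}" "l \<in> {1..n}" "moment_curve idx (t k) = moment_curve idx (t l)"
  have "1 \<in> idx ` UNIV" using idx by (simp add: bij_betw_def Suc_le_eq)
  then obtain i where i: "idx i = 1" by (metis imageE)
  have "t k = t l" using arg_cong[OF kl(3), of "\<lambda>x. x $ i"] by (simp add: moment_curve_def i)
  then show "k = l" using kl strict_mono_on_imp_inj_on[OF t] by (auto dest: inj_onD)
qed

text \<open>
Polynomials of degree at most \<open>d\<close> are the affine functionals on the moment curve, so one that is
nonnegative at the parameters cuts out the face spanned by its zeros.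
\<close>

lemma cyclic_polytope_face:
  assumes deg: "degree q \<le> CARD('d)" and nonneg: "\<And>k. k \<in> {1..n} \<Longrightarrow> poly q (t k) \<ge> 0"
  shows "(convex hull ((\<lambda>k. moment_curve idx (t k)) ` {k \<in> {1..n}. poly q (t k) = 0}))
    face_of cyclic_polytope idx n t"
proof -
  let ?S = "(\<lambda>k. moment_curve idx (t k)) ` {1..n}"
  note val = poly_conv_moment_curve[OF idx deg]
  have "{x \<in> ?S. coeff_vector idx q \<bullet> x = - coeff q 0}
      = (\<lambda>k. moment_curve idx (t k)) ` {k \<in> {1..n}. poly q (t k) = 0}"
    by (auto simp: val)
  moreover have "(convex hull {x \<in> ?S. coeff_vector idx q \<bullet> x = - coeff q 0}) face_of convex hull ?S"
  proof (rule face_of_convex_hull_supporting)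
    fix x assume "x \<in> ?S"
    then obtain k where "k \<in> {1..n}" "x = moment_curve idx (t k)" by blast
    then show "coeff_vector idx q \<bullet> x \<ge> - coeff q 0" using nonneg[of k] val[of "t k"] by simp
  qed simp
  ultimately show ?thesis unfolding cyclic_polytope_def by simp
qed

lemma vertices_cyclic_polytope:
  assumes "CARD('d) \<ge> 2"
  shows "vertices (cyclic_polytope idx n t) = (\<lambda>k. moment_curve idx (t k)) ` {1..n}"
proof (intro equalityI subsetI)
  fix v assume "v \<in> vertices (cyclic_polytope idx n t)"
  then show "v \<in> (\<lambda>k. moment_curve idx (t k)) ` {1..n}"
    unfolding vertices_def cyclic_polytope_def using extreme_point_of_convex_hull by blast
next
  fix v assume "v \<in> (\<lambda>k. moment_curve idx (t k)) ` {1..n}"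
  then obtain k where k: "k \<in> {1..n}" "v = moment_curve idx (t k)" by blast
  have "{l \<in> {1..n}. poly ([:- t k, 1:] ^ 2) (t l) = 0} = {k}"
    using k(1) strict_mono_on_imp_inj_on[OF t] by (auto dest: inj_onD)
  then have "{v} face_of cyclic_polytope idx n t"
    using cyclic_polytope_face[of "[:- t k, 1:] ^ 2"] assms k(2) by (simp add: degree_linear_power)
  then show "v \<in> vertices (cyclic_polytope idx n t)" by (simp add: vertices_def face_of_singleton)
qed

text \<open>
If the points were in a hyperplane, the corresponding polynomial of degree at most \<open>d\<close> would have
\<open>n > d\<close> zeros.
\<close>

lemma cyclic_polytope_full:
  assumes d: "CARD('d) \<ge> 2" and n: "n \<ge> CARD('d) + 1"
  shows "cyclic_polytope idx n t \<in> full_polytopes n"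
proof -
  let ?S = "(\<lambda>k. moment_curve idx (t k)) ` {1..n}"
  have "aff_dim ?S = int DIM(real ^ 'd)"
  proof (rule ccontr)
    assume "aff_dim ?S \<noteq> int DIM(real ^ 'd)"
    then have "aff_dim ?S < int DIM(real ^ 'd)" using aff_dim_le_DIM[of ?S] by linarith
    then obtain a b where a: "a \<noteq> 0" "?S \<subseteq> {x. a \<bullet> x = b}"
      using aff_lowdim_subset_hyperplane by blast
    define q where "q = (\<Sum>i\<in>UNIV. monom (a $ i) (idx i)) - [:b:]"
    have idx_pos: "1 \<le> idx i \<and> idx i \<le> CARD('d)" for i using bij_betwE[OF idx] by simp
    have "degree q \<le> CARD('d)" unfolding q_def
      using idx_pos by (intro degree_diff_le degree_sum_le order_trans[OF degree_monom_le]) auto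
    moreover have cq: "coeff q (idx i) = a $ i" for i
    proof -
      have "coeff q (idx i) = (\<Sum>j\<in>UNIV. if idx j = idx i then a $ j else 0)"
        using idx_pos[of i] by (simp add: q_def coeff_sum coeff_pCons split: nat.split)
      also have "\<dots> = (\<Sum>j\<in>UNIV. if j = i then a $ j else 0)"
        using bij_betw_imp_inj_on[OF idx] by (intro sum.cong) (auto dest: injD)
      finally show ?thesis by simp
    qed
    moreover have "q \<noteq> 0" using a(1) cq by (auto simp: vec_eq_iff)
    moreover have "poly q (t k) = 0" if "k \<in> {1..n}" for k
    proof -
      have "a \<bullet> moment_curve idx (t k) = b" using a(2) that by blast
      then show ?thesis by (simp add: q_def poly_sum poly_monom inner_vec_def moment_curve_def)
    qed
    then have "t ` {1..n} \<subseteq> {x. poly q x = 0}" by auto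
    then have "card (t ` {1..n}) \<le> card {x. poly q x = 0}"
      using poly_roots_finite[OF \<open>q \<noteq> 0\<close>] by (intro card_mono)
    then have "n \<le> degree q"
      using card_poly_roots_bound[OF \<open>q \<noteq> 0\<close>] card_image[OF strict_mono_on_imp_inj_on[OF t]] by simp
    ultimately show False using n by linarith
  qed
  then show ?thesis
    using vertices_cyclic_polytope[OF d] card_image[OF inj_moment_points]
    unfolding full_polytopes_def cyclic_polytope_def
    by (simp add: polytope_convex_hull aff_dim_convex_hull)
qed

text \<open>
The polynomial \<open>q\<close> gives the hyperplane, and the polynomials from the hypothesis \<open>edge\<close> show that every
point of \<open>A\<close> is joined by an edge to every point of \<open>B\<close>.
\<close>

lemma separated_edges_le_cv:
  assumes sub: "A \<subseteq> {1..n}" "B \<subseteq> {1..n}"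
    and q: "degree q \<le> CARD('d)"
    and above: "\<And>i. i \<in> A \<Longrightarrow> poly q (t i) > 0" and below: "\<And>j. j \<in> B \<Longrightarrow> poly q (t j) < 0"
    and edge: "\<And>i j. i \<in> A \<Longrightarrow> j \<in> B \<Longrightarrow> \<exists>p. degree p \<le> CARD('d) \<and>
      (\<forall>k\<in>{1..n}. poly p (t k) \<ge> 0 \<and> (poly p (t k) = 0 \<longleftrightarrow> k = i \<or> k = j))"
    and ne: "A \<noteq> {}" "B \<noteq> {}"
  shows "\<exists>H \<in> slicing_hyperplanes (cyclic_polytope idx n t). card A * card B \<le> cv (cyclic_polytope idx n t) H"
proof -
  let ?P = "cyclic_polytope idx n t" and ?f = "\<lambda>k. moment_curve idx (t k)"
  define a where "a = coeff_vector idx q"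
  define b where "b = - coeff q 0"
  have val: "poly q (t k) = a \<bullet> ?f k - b" for k
    using poly_conv_moment_curve[OF idx q, of "t k"] by (simp add: a_def b_def)
  have a0: "a \<noteq> 0"
  proof
    assume a: "a = 0"
    obtain i j where "i \<in> A" "j \<in> B" using ne by blast
    then show False using above[of i] below[of j] by (simp add: val a)
  qed
  have pol: "polytope ?P" unfolding cyclic_polytope_def by (simp add: polytope_convex_hull)
  have face: "closed_segment (?f i) (?f j) face_of ?P" if ij: "i \<in> A" "j \<in> B" for i j
  proof -
    obtain p where p: "degree p \<le> CARD('d)"
      "\<And>k. k \<in> {1..n} \<Longrightarrow> poly p (t k) \<ge> 0 \<and> (poly p (t k) = 0 \<longleftrightarrow> k = i \<or> k = j)"
      using edge[OF ij] by blast
    have "{k \<in> {1..n}. poly p (t k) = 0} = {i, j}" using p(2) sub ij by blast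
    then show ?thesis using cyclic_polytope_face[OF p(1)] p(2) by (simp add: segment_convex_hull)
  qed
  have "card A * card B = card (?f ` A \<times> ?f ` B)"
    using card_image[OF inj_on_subset[OF inj_moment_points]] sub by (simp add: card_cartesian_product)
  also have "\<dots> \<le> cv ?P {x. a \<bullet> x = b}"
    using face above below by (intro card_edges_le_cv[OF pol]) (auto simp: val)
  finally have cv: "card A * card B \<le> cv ?P {x. a \<bullet> x = b}" .
  have "finite A" "finite B" using sub finite_subset by auto
  then have "card A * card B > 0" using ne by (simp add: card_gt_0_iff)
  then have "vertices ({x. a \<bullet> x = b} \<inter> ?P) \<noteq> {}" using cv by (auto simp: cv_def)
  then have "{x. a \<bullet> x = b} \<inter> ?P \<noteq> {}" using vertices_subset by blast
  then have "{x. a \<bullet> x = b} \<in> slicing_hyperplanes ?P" using a0 by (auto simp: slicing_hyperplanes_def)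
  then show ?thesis using cv by blast
qed

lemma t_less: "k \<in> {1..n} \<Longrightarrow> l \<in> {1..n} \<Longrightarrow> k < l \<Longrightarrow> t k < t l"
  using t by (auto simp: strict_mono_on_def)

lemma t_le: "k \<in> {1..n} \<Longrightarrow> l \<in> {1..n} \<Longrightarrow> k \<le> l \<Longrightarrow> t k \<le> t l"
  using t_less[of k l] by (cases "k = l") auto

lemma t_eq_iff: "k \<in> {1..n} \<Longrightarrow> l \<in> {1..n} \<Longrightarrow> t k = t l \<longleftrightarrow> k = l"
  using t_less[of k l] t_less[of l k] by (metis less_irrefl linorder_neqE_nat)

text \<open>
In dimension at least 4 any two points are joined by an edge, because \<open>(x - t i)\<^sup>2 * (x - t j)\<^sup>2\<close>
has degree 4. So any hyperplane that cuts the points into two halves is good.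
\<close>

lemma neighborly_slice:
  assumes d: "CARD('d) \<ge> 4" and n: "n \<ge> 2"
  shows "\<exists>H \<in> slicing_hyperplanes (cyclic_polytope idx n t).
    n div 2 * (n - n div 2) \<le> cv (cyclic_polytope idx n t) H"
proof -
  define m where "m = n div 2"
  have m: "1 \<le> m" "m < n" using n by (auto simp: m_def)
  obtain c where c: "t m < c" "c < t (m + 1)" using t_less[of m "m + 1"] m dense by auto
  have "\<exists>H \<in> slicing_hyperplanes (cyclic_polytope idx n t).
    card {1..m} * card {m + 1..n} \<le> cv (cyclic_polytope idx n t) H"
  proof (rule separated_edges_le_cv[where q = "[:c, - 1:]"])
    show "poly [:c, - 1:] (t i) > 0" if "i \<in> {1..m}" for i
      using c m t_le[of i m] that by simp
    show "poly [:c, - 1:] (t j) < 0" if "j \<in> {m + 1..n}" for j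
      using c m t_le[of "m + 1" j] that by simp
    fix i j assume ij: "i \<in> {1..m}" "j \<in> {m + 1..n}"
    let ?p = "[:- t i, 1:] ^ 2 * [:- t j, 1:] ^ 2"
    have "degree ?p \<le> CARD('d)"
      using d degree_mult_le[of "[:- t i, 1:] ^ 2" "[:- t j, 1:] ^ 2"] by (simp add: degree_linear_power)
    moreover have "poly ?p (t k) = 0 \<longleftrightarrow> k = i \<or> k = j" if "k \<in> {1..n}" for k
      using that ij m t_eq_iff[of k i] t_eq_iff[of k j] by simp
    ultimately show "\<exists>p. degree p \<le> CARD('d) \<and>
      (\<forall>k\<in>{1..n}. poly p (t k) \<ge> 0 \<and> (poly p (t k) = 0 \<longleftrightarrow> k = i \<or> k = j))"
      by (intro exI[of _ ?p]) simp
  qed (use m d in auto)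
  then show ?thesis by (simp add: m_def)
qed

text \<open>
The cubics \<open>(x - t 1) * (x - t j)\<^sup>2\<close> and \<open>(t n - x) * (x - t j)\<^sup>2\<close> show that the first and the
last point are joined by an edge to every point in between, and a quadratic polynomial separates
these two points from the others.
\<close>

lemma endpoint_slice:
  assumes d: "CARD('d) \<ge> 3" and n: "n \<ge> 3"
  shows "\<exists>H \<in> slicing_hyperplanes (cyclic_polytope idx n t).
    2 * (n - 2) \<le> cv (cyclic_polytope idx n t) H"
proof -
  obtain c where c: "t 1 < c" "c < t 2" using t_less[of 1 2] n dense by auto
  have "t (n - 1) < t n" by (rule t_less) (use n in auto)
  then obtain c' where c': "t (n - 1) < c'" "c' < t n" using dense by blast
  have "\<exists>H \<in> slicing_hyperplanes (cyclic_polytope idx n t).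
    card {1, n} * card {2..n - 1} \<le> cv (cyclic_polytope idx n t) H"
  proof (rule separated_edges_le_cv[where q = "[:- c, 1:] * [:- c', 1:]"])
    have val: "poly ([:- c, 1:] * [:- c', 1:]) x = (x - c) * (x - c')" for x
      by (simp add: algebra_simps)
    have "t 2 \<le> t (n - 1)" using t_le[of 2 "n - 1"] n by simp
    then have "c < c'" using c c' by linarith
    then show "poly ([:- c, 1:] * [:- c', 1:]) (t i) > 0" if "i \<in> {1, n}" for i
      unfolding val using that c c' by (auto simp: zero_less_mult_iff)
    show "poly ([:- c, 1:] * [:- c', 1:]) (t i) < 0" if "i \<in> {2..n - 1}" for i
    proof -
      have "t 2 \<le> t i" by (rule t_le) (use that in auto)
      moreover have "t i \<le> t (n - 1)" by (rule t_le) (use that in auto)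
      ultimately show ?thesis unfolding val using c c' by (intro mult_pos_neg) auto
    qed
    fix i j assume ij: "i \<in> {1, n}" "j \<in> {2..n - 1}"
    let ?l = "if i = 1 then [:- t 1, 1:] else [:t n, - 1:]"
    have l: "poly ?l (t k) \<ge> 0 \<and> (poly ?l (t k) = 0 \<longleftrightarrow> k = i)" if k: "k \<in> {1..n}" for k
    proof -
      have "t 1 \<le> t k" "t k \<le> t n" by (rule t_le; use k in auto)+
      moreover have "t k = t i \<longleftrightarrow> k = i" using k ij n by (intro t_eq_iff) auto
      ultimately show ?thesis using ij by (cases "i = 1") auto
    qed
    have "degree (?l * [:- t j, 1:] ^ 2) \<le> CARD('d)"
      using d degree_mult_le[of ?l "[:- t j, 1:] ^ 2"] by (simp add: degree_linear_power split: if_splits)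
    moreover have "poly (?l * [:- t j, 1:] ^ 2) (t k) \<ge> 0
        \<and> (poly (?l * [:- t j, 1:] ^ 2) (t k) = 0 \<longleftrightarrow> k = i \<or> k = j)" if k: "k \<in> {1..n}" for k
    proof -
      have "poly (?l * [:- t j, 1:] ^ 2) (t k) = poly ?l (t k) * (t k - t j)\<^sup>2" by simp
      moreover have "t k = t j \<longleftrightarrow> k = j" using k ij by (intro t_eq_iff) auto
      ultimately show ?thesis using l[OF k] by simp
    qed
    ultimately show "\<exists>p. degree p \<le> CARD('d) \<and>
      (\<forall>k\<in>{1..n}. poly p (t k) \<ge> 0 \<and> (poly p (t k) = 0 \<longleftrightarrow> k = i \<or> k = j))"
      by blast
  qed (use n d in auto)
  moreover have "card {1, n} * card {2..n - 1} = 2 * (n - 2)" using n by simp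
  ultimately show ?thesis by metis
qed

end

section \<open>The maximal slices\<close>

definition slice_bound :: "nat \<Rightarrow> nat \<Rightarrow> nat" where
  "slice_bound d n = (if d = 3 then 2 * (n - 2) else n div 2 * (n - n div 2))"

lemma cv_le_slice_bound:
  fixes P :: "'a::euclidean_space set"
  assumes "DIM('a) \<ge> 3" "n \<ge> DIM('a) + 1" "P \<in> full_polytopes n" "H \<in> slicing_hyperplanes P"
  shows "cv P H \<le> slice_bound DIM('a) n"
proof -
  have P: "polytope P" "card (vertices P) = n" using assms(3) by (auto simp: full_polytopes_def)
  obtain a b where "a \<noteq> 0" "H = {x. a \<bullet> x = b}" using assms(4) by (auto simp: slicing_hyperplanes_def)
  then show ?thesis
    using cv_le_planar[OF _ _ P, of a b] cv_le_balanced[OF P, of a b] assms(1,2)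
    by (auto simp: slice_bound_def)
qed

text \<open>
The bound on all slices also makes the set in the definition of \<open>\<nu>\<close> finite, without which its maximum
would be unspecified; the second claim depends on that.
\<close>

lemma nu_le_slice_bound:
  fixes P :: "'a::euclidean_space set"
  assumes d: "DIM('a) \<ge> 3" and n: "n \<ge> DIM('a) + 1" and P: "P \<in> full_polytopes n"
  shows "\<nu> P \<le> slice_bound DIM('a) n"
    and "H \<in> slicing_hyperplanes P \<Longrightarrow> cv P H \<le> \<nu> P"
proof -
  have sub: "cv P ` slicing_hyperplanes P \<subseteq> {..slice_bound DIM('a) n}"
    using cv_le_slice_bound[OF d n P] by auto
  then have fin: "finite (cv P ` slicing_hyperplanes P)" by (rule finite_subset) simp
  have "vertices P \<noteq> {}" using P n by (auto simp: full_polytopes_def)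
  then obtain x where "x \<in> P" using vertices_subset by blast
  moreover obtain a :: 'a where "a \<noteq> 0" using nonzero_Basis nonempty_Basis by blast
  ultimately have "{y. a \<bullet> y = a \<bullet> x} \<in> slicing_hyperplanes P"
    unfolding slicing_hyperplanes_def by blast
  then have "cv P ` slicing_hyperplanes P \<noteq> {}" by blast
  then show "\<nu> P \<le> slice_bound DIM('a) n" unfolding \<nu>_def using fin sub by (auto simp: Max_le_iff)
  show "cv P H \<le> \<nu> P" if "H \<in> slicing_hyperplanes P"
    unfolding \<nu>_def using fin that by (intro Max_ge) auto
qed

lemma nu_cyclic_polytope:
  fixes idx :: "'d::finite \<Rightarrow> nat"
  assumes idx: "bij_betw idx UNIV {1..CARD('d)}" and t: "strict_mono_on {1..n} t"
    and d: "CARD('d) \<ge> 3" and n: "n \<ge> CARD('d) + 1"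
  shows "\<nu> (cyclic_polytope idx n t) = slice_bound CARD('d) n"
proof (rule antisym)
  have full: "cyclic_polytope idx n t \<in> full_polytopes n"
    using cyclic_polytope_full[OF idx t _ n] d by simp
  have d': "DIM(real ^ 'd) \<ge> 3" "n \<ge> DIM(real ^ 'd) + 1" using d n by auto
  show "\<nu> (cyclic_polytope idx n t) \<le> slice_bound CARD('d) n"
    using nu_le_slice_bound(1)[OF d' full] by simp
  have "\<exists>H \<in> slicing_hyperplanes (cyclic_polytope idx n t).
      slice_bound CARD('d) n \<le> cv (cyclic_polytope idx n t) H"
    using endpoint_slice[OF idx t d] neighborly_slice[OF idx t] d n
    by (cases "CARD('d) = 3") (auto simp: slice_bound_def)
  then show "slice_bound CARD('d) n \<le> \<nu> (cyclic_polytope idx n t)"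
    using nu_le_slice_bound(2)[OF d' full] order_trans by blast
qed

theorem theorem1p1:
  fixes idx :: "'d::finite \<Rightarrow> nat" and n :: nat
  assumes "bij_betw idx UNIV {1..CARD('d)}"
    and "CARD('d) \<ge> 3"
    and "n \<ge> CARD('d) + 1"
  shows "(\<forall>t. strict_mono_on {1..n} t \<longrightarrow>
            cyclic_polytope idx n t \<in> full_polytopes n \<and>
            (\<forall>P \<in> (full_polytopes n :: (real ^ 'd) set set). \<nu> P \<le> \<nu> (cyclic_polytope idx n t)))
       \<and> Max (\<nu> ` (full_polytopes n :: (real ^ 'd) set set)) =
           (if CARD('d) = 3 then 2 * (n - 2)
            else nat \<lfloor>real n / 2\<rfloor> * nat \<lceil>real n / 2\<rceil>)"
proof -
  let ?F = "full_polytopes n :: (real ^ 'd) set set"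
  have le: "\<nu> P \<le> slice_bound CARD('d) n" if "P \<in> ?F" for P
    using nu_le_slice_bound(1)[OF _ _ that] assms by simp
  have full: "cyclic_polytope idx n t \<in> ?F" if "strict_mono_on {1..n} t" for t
    using cyclic_polytope_full[OF assms(1) that _ assms(3)] assms(2) by simp
  note nu = nu_cyclic_polytope[OF assms(1) _ assms(2,3)]
  have real: "strict_mono_on {1..n} real" by (simp add: strict_mono_on_def)
  have "Max (\<nu> ` ?F) = slice_bound CARD('d) n"
  proof (rule Max_eqI)
    have "\<nu> ` ?F \<subseteq> {..slice_bound CARD('d) n}" using le by auto
    then show "finite (\<nu> ` ?F)" by (rule finite_subset) simp
    show "slice_bound CARD('d) n \<in> \<nu> ` ?F" using nu[OF real] full[OF real] by (metis imageI)
  qed (use le in auto)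
  moreover have "nat \<lfloor>real n / 2\<rfloor> = n div 2" "nat \<lceil>real n / 2\<rceil> = n - n div 2"
    by linarith+
  ultimately show ?thesis using full le nu by (auto simp: slice_bound_def)
qed

end
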